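(* Consider the algorithm ABrA-GD in the setting of the context, assume $d^*$ is twice differentiable, and let $\rho_k$ be the local distortion of iteration $k$ (defined in the context). Suppose there exist $K\ge0$ and $\rho$ such that the inner loop of ABrA-GD exits at every iteration $k<K$ and $\rho_k\le\rho$ for all $k\ge K$. Then the inner loop exits at every iteration, and there is a finite $\bar K\ge K$ (with $\bar K\ge 1$) such that, for all $k\ge\bar K$, $$M_k\le4\rho^2L\ \text{ if }\mu=0,\qquad M_k\le4\rho^4L\ \text{ if }\mu>0,$$ where $M_k$ is the accepted acceleration parameter. Consequently, for any $x_\star\in\arg\min_x\phi(x)$ and all $k\ge\bar K$, $\phi_k^{\mathrm{best}}-\phi_\star\le\eta_k^{-1}D_d(x_\star,x_0)$ with $$\eta_k^{-1}\le\frac{\eta_{\bar K}^{-1}}{\left(1+\frac{k-\bar K}{4\rho\sqrt{L\eta_{\bar K}}}\right)^2}\quad(\mu=0),\qquad \eta_k^{-1}\le\eta_{\bar K}^{-1}\left(1-\sqrt{\frac{\mu}{4\rho^4L}}\right)^{k-\bar K}\quad(\mu>0).$$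
   Context: Setting. $d:\mathbb R^n\to\mathbb R\cup\{+\infty\}$ is a Legendre function: proper, closed, convex, differentiable on $\operatorname{int}(\operatorname{dom} d)$ with $\|\nabla d(u_j)\|\to\infty$ whenever $u_j$ tends to a boundary point of $\operatorname{dom} d$, and strictly convex on every convex subset of $\operatorname{dom}\partial d$; $d^*$ is its Fenchel conjugate, and $\nabla d:\operatorname{int}(\operatorname{dom} d)\to\operatorname{int}(\operatorname{dom} d^* )$ is a bijection with inverse $\nabla d^*$. The Bregman divergence is $D_d(x,y)=d(x)-d(y)-\langle\nabla d(y),x-y\rangle$. $\mathcal X=\operatorname{cl}(\operatorname{dom} d)$, $x_0\in\operatorname{int}(\operatorname{dom} d)$. $f:\mathcal X\to\mathbb R$ is convex, differentiable, and relatively $(L-\mu)$-smooth with respect to $d$, i.e. $f(x)-f(y)-\langle\nabla f(y),x-y\rangle\le(L-\mu)D_d(x,y)$ for $x,y\in\operatorname{int}(\mathcal X)$, with $0\le\mu<L$. The objective is $\phi(x)=f(x)+\mu D_d(x,x_0)$, $\phi_\star=\min_{\mathcal X}\phi$; equivalently $\mu D_d(x,y)\le\phi(x)-\phi(y)-\langle\nabla\phi(y),x-y\rangle\le LD_d(x,y)$. Standing convention: all minimizers appearing (of $\phi$ and of the subproblems) exist and lie in $\operatorname{int}(\operatorname{dom} d)$. Algorithm ABrA-GD. Inputs: $x_0$, $\mu$, $\phi$, initial estimates $L_{\mathrm{cur}}=L_0>0$ and $M_{-1}>0$. Initialization: $x_0^{\mathrm{best}}=z_0=x_0$, $\lambda_0=0$,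 $\eta_0=0$ (with $\eta_0^{-1}=+\infty$), $\phi_0^{\mathrm{best}}=\phi(x_0)$, $t_0=1$. For $k=0,1,2,\dots$: set $M_k\leftarrow\max\{M_{k-1}/4,\mu\}$, $L_{\mathrm{cur}}\leftarrow\max\{L_{\mathrm{cur}}/2,\mu\}$, $\phi^{\mathrm{best}}_{k+1}\leftarrow\phi^{\mathrm{best}}_k$, $x^{\mathrm{best}}_{k+1}\leftarrow x^{\mathrm{best}}_k$; then run the inner loop, repeating the following trial until the exit condition holds: (1) $M_k\leftarrow2M_k$. For $k\ge1$, $t_k=\min\left\{1,\frac{2(\eta_k^{-1}+\mu)}{\eta_k^{-1}+\sqrt{\eta_k^{-2}+4M_k(\eta_k^{-1}+\mu)}}\right\}$ (and $t_0=1$); $\eta_{k+1}^{-1}=M_kt_k^2-\mu$; $\tau_k=\frac{t_k-\mu/\sqrt{M_kL_{\mathrm{cur}}}}{1-\mu/\sqrt{M_kL_{\mathrm{cur}}}}$. (2) $y_k=(1-\tau_k)x_k^{\mathrm{best}}+\tau_kz_k$ and $\phi_k^{\mathrm{low}}=\phi(y_k)+\langle\nabla\phi(y_k),z_k-y_k\rangle+\mu D_d(z_k,y_k)$. (3) Backtracking gradient step: starting from $L_{\mathrm{new}}=L_{\mathrm{cur}}/2$, repeat $L_{\mathrm{new}}\leftarrow2L_{\mathrm{new}}$, $x_{k+1}=\arg\min_x\{\langle\nabla\phi(y_k),x\rangle+L_{\mathrm{new}}D_d(x,y_k)\}$ until $\phi(x_{k+1})\le\phi(y_k)+\langle\nabla\phi(y_k),x_{k+1}-y_k\rangle+L_{\mathrm{new}}D_d(x_{k+1},y_k)$;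 then $L_{\mathrm{cur}}\leftarrow L_{\mathrm{new}}$. (4) $\lambda_{k+1}=(1-t_k)\lambda_k+t_k\nabla f(y_k)$, where $\nabla f(y_k)=\nabla\phi(y_k)-\mu(\nabla d(y_k)-\nabla d(x_0))$, and $z_{k+1}=\arg\min_u\{\langle\lambda_{k+1},u\rangle+(\mu+\eta_{k+1}^{-1})D_d(u,x_0)\}$. (5) If $\phi^{\mathrm{best}}_{k+1}>\phi(x_{k+1})$, then $\phi^{\mathrm{best}}_{k+1}\leftarrow\phi(x_{k+1})$ and $x^{\mathrm{best}}_{k+1}\leftarrow x_{k+1}$. Exit condition: $\phi^{\mathrm{best}}_{k+1}\le(1-t_k)\phi_k^{\mathrm{best}}+t_k\phi_k^{\mathrm{low}}-(\mu+\eta_{k+1}^{-1})D_d(z_k,z_{k+1})$. The value of $M_k$ (and of the other quantities) at exit is called accepted. Local distortion. For $\Omega\subset\operatorname{int}(\operatorname{dom} d^* )$ on which $d^*$ is twice differentiable with positive definite Hessian, $\rho_{d^*}(\Omega)=\sup_{w_1,w_2\in\Omega}\sup_{\xi\ne0}\left(\frac{\langle\xi,\nabla^2d^*(w_2)\xi\rangle}{\langle\xi,\nabla^2d^*(w_1)\xi\rangle}\right)^{1/2}$. For iteration $k$, $\Omega_k$ is the convex hull of the dual segments of all trials of the $M_k$-search (inner loop) in iteration $k$, and $\rho_k=\rho_{d^*}(\Omega_k)$. The dual segments of a trial are the segment from $\nabla d(y_k)$ to $\nabla d(x_{k+1})$ and the segment from $\nabla d(z_k)$ to $\nabla d(z_{k+1})$;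 when $\mu>0$, they also include the segments from $\nabla d(y_k)$ and from $\nabla d(z_k)$ to $\nabla d(q_{k+1})$, where $q_{k+1}=\nabla d^*\left(\nabla d(y_k)-\frac1\mu\nabla\phi(y_k)\right)$, which is assumed well defined, i.e. $\nabla d(y_k)-\frac1\mu\nabla\phi(y_k)\in\operatorname{int}(\operatorname{dom} d^* )$. *)

theory Defs
  imports "HOL-Analysis.Analysis"
begin

section \<open>Extended-valued convex functions\<close>

text \<open>Functions into the extended reals. Derivatives are taken of their real-valued version
  \<open>real_of_ereal \<circ> g\<close>, which agrees with \<open>g\<close> near every interior point of the effective domain
  of a proper \<open>g\<close>.\<close>

definition edom :: "('a \<Rightarrow> ereal) \<Rightarrow> 'a set" where
  "edom g = {x. g x < \<infinity>}"

definition gradient :: "('a::real_inner \<Rightarrow> real) \<Rightarrow> 'a \<Rightarrow> 'a" where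
  "gradient g x = (THE v. GDERIV g x :> v)"

definition egradient :: "('a::real_inner \<Rightarrow> ereal) \<Rightarrow> 'a \<Rightarrow> 'a" where
  "egradient g = gradient (\<lambda>x. real_of_ereal (g x))"

definition proper_fun :: "('a \<Rightarrow> ereal) \<Rightarrow> bool" where
  "proper_fun g \<longleftrightarrow> (\<forall>x. g x \<noteq> -\<infinity>) \<and> (\<exists>x. g x \<noteq> \<infinity>)"

definition ereal_epigraph :: "('a \<Rightarrow> ereal) \<Rightarrow> ('a \<times> real) set" where
  "ereal_epigraph g = {(x, r). g x \<le> ereal r}"

definition subdifferential :: "('a::real_inner \<Rightarrow> ereal) \<Rightarrow> 'a \<Rightarrow> 'a set" where
  "subdifferential g x =
     {v. x \<in> edom g \<and> (\<forall>y. g x + ereal (inner v (y - x)) \<le> g y)}"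

definition dom_subdifferential :: "('a::real_inner \<Rightarrow> ereal) \<Rightarrow> 'a set" where
  "dom_subdifferential g = {x. subdifferential g x \<noteq> {}}"

definition strictly_convex_on :: "'a::real_vector set \<Rightarrow> ('a \<Rightarrow> ereal) \<Rightarrow> bool" where
  "strictly_convex_on C g \<longleftrightarrow>
     (\<forall>x\<in>C. \<forall>y\<in>C. \<forall>u. x \<noteq> y \<longrightarrow> 0 < u \<longrightarrow> u < 1 \<longrightarrow>
        g ((1 - u) *\<^sub>R x + u *\<^sub>R y) < ereal (1 - u) * g x + ereal u * g y)"

definition legendre :: "('a::euclidean_space \<Rightarrow> ereal) \<Rightarrow> bool" where
  "legendre d \<longleftrightarrow>
     proper_fun d \<and> closed (ereal_epigraph d) \<and> convex (ereal_epigraph d) \<and>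
     (\<forall>x\<in>interior (edom d). \<exists>v. GDERIV (\<lambda>x. real_of_ereal (d x)) x :> v) \<and>
     (\<forall>u b. (\<forall>j::nat. u j \<in> interior (edom d)) \<longrightarrow> b \<in> frontier (edom d) \<longrightarrow> u \<longlonglongrightarrow> b \<longrightarrow>
        filterlim (\<lambda>j. norm (egradient d (u j))) at_top sequentially) \<and>
     (\<forall>C. C \<subseteq> dom_subdifferential d \<longrightarrow> convex C \<longrightarrow> strictly_convex_on C d)"

definition conjugate :: "('a::real_inner \<Rightarrow> ereal) \<Rightarrow> 'a \<Rightarrow> ereal" where
  "conjugate d w = (SUP x. ereal (inner w x) - d x)"

definition bregman :: "('a::real_inner \<Rightarrow> ereal) \<Rightarrow> 'a \<Rightarrow> 'a \<Rightarrow> ereal" where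
  "bregman d x y = d x - d y - ereal (inner (egradient d y) (x - y))"

definition relatively_smooth ::
    "real \<Rightarrow> ('a::real_inner \<Rightarrow> ereal) \<Rightarrow> 'a set \<Rightarrow> ('a \<Rightarrow> real) \<Rightarrow> bool" where
  "relatively_smooth c d S f \<longleftrightarrow>
     (\<forall>x\<in>S. \<forall>y\<in>S.
        ereal (f x - f y - inner (gradient f y) (x - y)) \<le> ereal c * bregman d x y)"

definition twice_differentiable_at :: "('a::real_inner \<Rightarrow> ereal) \<Rightarrow> 'a \<Rightarrow> bool" where
  "twice_differentiable_at g w \<longleftrightarrow>
     (\<exists>v. GDERIV (\<lambda>x. real_of_ereal (g x)) w :> v) \<and> egradient g differentiable (at w)"

definition hessian :: "('a::real_inner \<Rightarrow> ereal) \<Rightarrow> 'a \<Rightarrow> 'a \<Rightarrow> 'a" where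
  "hessian g w = frechet_derivative (egradient g) (at w)"

definition distortion_defined :: "('a::real_inner \<Rightarrow> ereal) \<Rightarrow> 'a set \<Rightarrow> bool" where
  "distortion_defined g \<Omega> \<longleftrightarrow>
     \<Omega> \<subseteq> interior (edom g) \<and>
     (\<forall>w\<in>\<Omega>. twice_differentiable_at g w \<and> (\<forall>\<xi>. \<xi> \<noteq> 0 \<longrightarrow> 0 < inner \<xi> (hessian g w \<xi>)))"

definition distortion :: "('a::real_inner \<Rightarrow> ereal) \<Rightarrow> 'a set \<Rightarrow> ereal" where
  "distortion g \<Omega> =
     (SUP w1\<in>\<Omega>. SUP w2\<in>\<Omega>. SUP \<xi>\<in>-{0}.
        ereal (sqrt (inner \<xi> (hessian g w2 \<xi>) / inner \<xi> (hessian g w1 \<xi>))))"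

definition minimizers_interior ::
    "('a::topological_space \<Rightarrow> ereal) \<Rightarrow> 'a set \<Rightarrow> ('a \<Rightarrow> ereal) \<Rightarrow> bool" where
  "minimizers_interior d S F \<longleftrightarrow>
     (\<exists>x. is_arg_min F (\<lambda>x. x \<in> S) x) \<and>
     (\<forall>x. is_arg_min F (\<lambda>x. x \<in> S) x \<longrightarrow> x \<in> interior (edom d))"


section \<open>The algorithm\<close>

text \<open>\<open>abra_state\<close> is what iteration \<open>k\<close> receives: \<open>M\<^bsub>k-1\<^esub>\<close>, \<open>L\<^bsub>cur\<^esub>\<close>, \<open>\<phi>\<^bsub>k\<^esub>\<^bsup>best\<^esup>\<close>,
  \<open>x\<^bsub>k\<^esub>\<^bsup>best\<^esup>\<close>, \<open>z\<^bsub>k\<^esub>\<close>, \<open>\<lambda>\<^bsub>k\<^esub>\<close>, \<open>\<eta>\<^bsub>k\<^esub>\<close>.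
  A trial of iteration \<open>k\<close> computes the corresponding quantities for iteration \<open>k + 1\<close>, so
  in \<open>abra_trial\<close> the same fields hold \<open>M\<^bsub>k\<^esub>\<close>, the new \<open>L\<^bsub>cur\<^esub>\<close>, \<open>\<phi>\<^bsub>k+1\<^esub>\<^bsup>best\<^esup>\<close>,
  \<open>x\<^bsub>k+1\<^esub>\<^bsup>best\<^esup>\<close>, \<open>z\<^bsub>k+1\<^esub>\<close>, \<open>\<lambda>\<^bsub>k+1\<^esub>\<close>, \<open>\<eta>\<^bsub>k+1\<^esub>\<close>; the field \<open>st_Lin\<close> is the value of \<open>L\<^bsub>cur\<^esub>\<close>
  with which the trial starts.\<close>

record 'v abra_state =
  st_M :: real
  st_L :: real
  st_phibest :: real
  st_xbest :: 'v
  st_z :: 'v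
  st_lambda :: 'v
  st_eta :: real

record 'v abra_trial = "'v abra_state" +
  st_Lin :: real
  st_t :: real
  st_tau :: real
  st_y :: 'v
  st_philow :: real
  st_xnext :: 'v

context
  fixes d :: "real^'n \<Rightarrow> ereal" and f :: "real^'n \<Rightarrow> real" and \<mu> :: real and x0 :: "real^'n"
    and L0 :: real and Minit :: real
begin

definition objective :: "real^'n \<Rightarrow> ereal" where
  "objective x = ereal (f x) + ereal \<mu> * bregman d x x0"

abbreviation phi :: "real^'n \<Rightarrow> real" where
  "phi x \<equiv> real_of_ereal (objective x)"

abbreviation grad_phi :: "real^'n \<Rightarrow> real^'n" where
  "grad_phi \<equiv> egradient objective"

abbreviation breg :: "real^'n \<Rightarrow> real^'n \<Rightarrow> real" where
  "breg x y \<equiv> real_of_ereal (bregman d x y)"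

definition x_subproblem :: "real^'n \<Rightarrow> real \<Rightarrow> real^'n \<Rightarrow> ereal" where
  "x_subproblem y Lnew x = ereal (inner (grad_phi y) x) + ereal Lnew * bregman d x y"

definition x_step :: "real^'n \<Rightarrow> real \<Rightarrow> real^'n" where
  "x_step y Lnew = arg_min (x_subproblem y Lnew) (\<lambda>x. x \<in> UNIV)"

definition x_step_ok :: "real^'n \<Rightarrow> real \<Rightarrow> bool" where
  "x_step_ok y Lnew \<longleftrightarrow>
     (let x = x_step y Lnew
      in phi x \<le> phi y + inner (grad_phi y) (x - y) + Lnew * breg x y)"

text \<open>The backtracking tries \<open>Lcur\<close>, \<open>2 Lcur\<close>, \<open>4 Lcur\<close>, ... and stops at the first success.\<close>

definition backtrack :: "real^'n \<Rightarrow> real \<Rightarrow> real" where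
  "backtrack y Lcur = Lcur * 2 ^ (LEAST i. x_step_ok y (Lcur * 2 ^ i))"

definition z_subproblem :: "real^'n \<Rightarrow> real \<Rightarrow> real^'n \<Rightarrow> ereal" where
  "z_subproblem lam' \<eta>' u = ereal (inner lam' u) + ereal (\<mu> + inverse \<eta>') * bregman d u x0"

definition z_step :: "real^'n \<Rightarrow> real \<Rightarrow> real^'n" where
  "z_step lam' \<eta>' = arg_min (z_subproblem lam' \<eta>') (\<lambda>u. u \<in> UNIV)"

text \<open>One trial of iteration \<open>k\<close>, entered in state \<open>s\<close>; the remaining arguments are the values
  of \<open>M\<^bsub>k\<^esub>\<close>, \<open>L\<^bsub>cur\<^esub>\<close>, \<open>\<phi>\<^bsub>k+1\<^esub>\<^bsup>best\<^esup>\<close>, \<open>x\<^bsub>k+1\<^esub>\<^bsup>best\<^esup>\<close> when the trial starts.\<close>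

definition trial :: "nat \<Rightarrow> (real^'n) abra_state \<Rightarrow> real \<Rightarrow> real \<Rightarrow> real \<Rightarrow> real^'n
    \<Rightarrow> (real^'n) abra_trial" where
  "trial k s M_old L_old pb_old xb_old =
    (let
       M = 2 * M_old;
       e = inverse (st_eta s);
       t = (if k = 0 then 1
            else min 1 (2 * (e + \<mu>) / (e + sqrt (e\<^sup>2 + 4 * M * (e + \<mu>)))));
       \<eta>' = inverse (M * t\<^sup>2 - \<mu>);
       \<theta> = \<mu> / sqrt (M * L_old);
       \<tau> = (t - \<theta>) / (1 - \<theta>);
       y = (1 - \<tau>) *\<^sub>R st_xbest s + \<tau> *\<^sub>R st_z s;
       philow = phi y + inner (grad_phi y) (st_z s - y) + \<mu> * breg (st_z s) y;
       L = backtrack y L_old;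
       x = x_step y L;
       grad_f = grad_phi y - \<mu> *\<^sub>R (egradient d y - egradient d x0);
       lam' = (1 - t) *\<^sub>R st_lambda s + t *\<^sub>R grad_f;
       z = z_step lam' \<eta>'
     in \<lparr>st_M = M, st_L = L,
         st_phibest = (if pb_old > phi x then phi x else pb_old),
         st_xbest = (if pb_old > phi x then x else xb_old),
         st_z = z, st_lambda = lam', st_eta = \<eta>',
         st_Lin = L_old, st_t = t, st_tau = \<tau>, st_y = y, st_philow = philow, st_xnext = x\<rparr>)"

text \<open>The trials of the inner loop of iteration \<open>k\<close>, continued past the exit; those that are
  actually carried out are singled out by \<open>executed\<close>.\<close>

primrec trials :: "nat \<Rightarrow> (real^'n) abra_state \<Rightarrow> nat \<Rightarrow> (real^'n) abra_trial" where
  "trials k s 0 =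
     trial k s (max (st_M s / 4) \<mu>) (max (st_L s / 2) \<mu>) (st_phibest s) (st_xbest s)"
| "trials k s (Suc j) =
     (let r = trials k s j in trial k s (st_M r) (st_L r) (st_phibest r) (st_xbest r))"

definition exit_condition :: "(real^'n) abra_state \<Rightarrow> (real^'n) abra_trial \<Rightarrow> bool" where
  "exit_condition s r \<longleftrightarrow>
     st_phibest r \<le> (1 - st_t r) * st_phibest s + st_t r * st_philow r
        - (\<mu> + inverse (st_eta r)) * breg (st_z s) (st_z r)"

definition executed :: "nat \<Rightarrow> (real^'n) abra_state \<Rightarrow> nat \<Rightarrow> bool" where
  "executed k s j \<longleftrightarrow> (\<forall>i<j. \<not> exit_condition s (trials k s i))"

text \<open>\<open>st_eta = 0\<close> in the initial state stands for \<open>\<eta>\<^bsub>0\<^esub>\<^bsup>-1\<^esup> = +\<infinity>\<close>. The HOL value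
  \<open>inverse 0 = 0\<close> is never used: \<open>\<eta>\<^bsub>0\<^esub>\<^bsup>-1\<^esup>\<close> would only enter \<open>t\<^bsub>0\<^esub>\<close>, which is set to 1.\<close>

definition initial_state :: "(real^'n) abra_state" where
  "initial_state =
     \<lparr>st_M = Minit, st_L = L0, st_phibest = phi x0, st_xbest = x0,
      st_z = x0, st_lambda = 0, st_eta = 0\<rparr>"

text \<open>The state in which iteration \<open>k\<close> is entered, or \<open>None\<close> if the inner loop of an earlier
  iteration does not exit.\<close>

primrec abra_run :: "nat \<Rightarrow> (real^'n) abra_state option" where
  "abra_run 0 = Some initial_state"
| "abra_run (Suc k) =
     (case abra_run k of
        None \<Rightarrow> None
      | Some s \<Rightarrow>
          if \<exists>j. exit_condition s (trials k s j)
          then Some (abra_state.truncate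
                 (trials k s (LEAST j. exit_condition s (trials k s j))))
          else None)"

definition inner_loop_exits :: "nat \<Rightarrow> bool" where
  "inner_loop_exits k \<longleftrightarrow>
     (\<exists>s. abra_run k = Some s \<and> (\<exists>j. exit_condition s (trials k s j)))"

definition accepted_M :: "nat \<Rightarrow> real" where
  "accepted_M k = st_M (the (abra_run (Suc k)))"

definition phi_best :: "nat \<Rightarrow> real" where
  "phi_best k = st_phibest (the (abra_run k))"

definition eta :: "nat \<Rightarrow> real" where
  "eta k = st_eta (the (abra_run k))"

text \<open>Every minimization carried out during the run has a minimizer, and its minimizers are
  interior points; for the gradient step this includes each tentative value of \<open>L\<^bsub>new\<^esub>\<close>.\<close>

definition subproblems_solvable :: bool where
  "subproblems_solvable \<longleftrightarrow>
     (\<forall>k s j. abra_run k = Some s \<longrightarrow> executed k s j \<longrightarrow>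
        (let r = trials k s j
         in (\<forall>i. (\<forall>i'<i. \<not> x_step_ok (st_y r) (st_Lin r * 2 ^ i')) \<longrightarrow>
                minimizers_interior d UNIV (x_subproblem (st_y r) (st_Lin r * 2 ^ i))) \<and>
            minimizers_interior d UNIV (z_subproblem (st_lambda r) (st_eta r))))"

definition dual_q :: "(real^'n) abra_trial \<Rightarrow> real^'n" where
  "dual_q r = egradient d (st_y r) - (1 / \<mu>) *\<^sub>R grad_phi (st_y r)"

definition dual_segments ::
    "(real^'n) abra_state \<Rightarrow> (real^'n) abra_trial \<Rightarrow> (real^'n) set" where
  "dual_segments s r =
     closed_segment (egradient d (st_y r)) (egradient d (st_xnext r)) \<union>
     closed_segment (egradient d (st_z s)) (egradient d (st_z r)) \<union>
     (if \<mu> > 0 then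
        (let q = egradient (conjugate d) (dual_q r)
         in closed_segment (egradient d (st_y r)) (egradient d q) \<union>
            closed_segment (egradient d (st_z s)) (egradient d q))
      else {})"

definition Omega :: "nat \<Rightarrow> (real^'n) abra_state \<Rightarrow> (real^'n) set" where
  "Omega k s = convex hull (\<Union>j\<in>{j. executed k s j}. dual_segments s (trials k s j))"

text \<open>The local distortion of iteration \<open>k\<close>, entered in state \<open>s\<close>, is well defined and at most
  \<open>\<rho>\<close>.\<close>

definition local_distortion_le :: "nat \<Rightarrow> (real^'n) abra_state \<Rightarrow> real \<Rightarrow> bool" where
  "local_distortion_le k s \<rho> \<longleftrightarrow>
     (\<mu> > 0 \<longrightarrow> (\<forall>j. executed k s j \<longrightarrow>
        dual_q (trials k s j) \<in> interior (edom (conjugate d)))) \<and>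
     distortion_defined (conjugate d) (Omega k s) \<and>
     distortion (conjugate d) (Omega k s) \<le> ereal \<rho>"

end

end

theory Submission
  imports Defs
begin

text \<open>
  The iterates satisfy \<open>\<phi>\<^sub>k\<^bsup>best\<^esup> \<le> min\<^sub>u (A\<^sub>k + \<langle>\<lambda>\<^sub>k, u\<rangle> + (\<mu> + \<eta>\<^sub>k\<^bsup>-1\<^esup>) D(u, x\<^sub>0))\<close>, where \<open>A\<^sub>k + \<langle>\<lambda>\<^sub>k, u\<rangle>\<close>
  is an average of tangents of \<open>f\<close>; the exit condition is what carries this from \<open>k\<close> to \<open>k + 1\<close>,
  and it gives the bound \<open>\<eta>\<^sub>k\<^bsup>-1\<^esup> D(x\<^sub>\<star>, x\<^sub>0)\<close>.

  A trial exits once \<open>L\<^sub>n\<^sub>e\<^sub>w D(y, x\<^sub>+)\<close> dominates \<open>M t\<^sup>2 D(z, z\<^sub>+)\<close>. Both are Bregman divergences of \<open>d\<^sup>*\<close> along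
  parallel dual segments (\<open>\<mu> = 0\<close>), or along fractions of segments that end in \<open>\<nabla>d(q)\<close> (\<open>\<mu> > 0\<close>), so a
  second-order Taylor expansion compares them up to the factor \<open>\<rho>\<^sup>2\<close>. For \<open>\<mu> = 0\<close> it suffices that
  \<open>M \<ge> \<rho>\<^sup>2 L\<^sub>n\<^sub>e\<^sub>w\<close>, and eventually \<open>L\<^sub>n\<^sub>e\<^sub>w \<le> 2 L\<close>.

  For \<open>\<mu> > 0\<close> the point \<open>y\<close> is computed with the value \<open>L\<^sub>o\<^sub>l\<^sub>d\<close> from before the backtracking, and a trial
  can fail with a large \<open>M\<close> if the backtracking then raises \<open>L\<^sub>o\<^sub>l\<^sub>d\<close> a lot. Follow the ratio
  \<open>M / L\<^sub>o\<^sub>l\<^sub>d\<close>: a failing trial with \<open>M \<ge> 2 \<rho>\<^sup>4 L\<close> needs at least two doublings of \<open>L\<^sub>o\<^sub>l\<^sub>d\<close> and hence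
  halves the ratio, and no trial raises it above \<open>2 \<rho>\<^sup>4\<close>. So either such failures stop, and then \<open>M\<close> is
  halved until \<open>M \<le> 4 \<rho>\<^sup>4 L\<close>, or the ratio drops below \<open>2 \<rho>\<^sup>4\<close> for good, and then
  \<open>M \<le> 2 \<rho>\<^sup>4 L\<^sub>o\<^sub>l\<^sub>d \<le> 4 \<rho>\<^sup>4 L\<close>.
\<close>

section \<open>Convexity, Taylor expansion and distortion\<close>

lemma gderiv_gradient:
  assumes "GDERIV g x :> v"
  shows "gradient g x = v"
  unfolding gradient_def
proof (rule the_equality)
  fix u assume "GDERIV g x :> u"
  then have "(\<lambda>h. h \<bullet> u) = (\<lambda>h. h \<bullet> v)"
    using assms unfolding gderiv_def by (rule has_derivative_unique)
  then have "(u - v) \<bullet> u = (u - v) \<bullet> v" by meson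
  then have "(u - v) \<bullet> (u - v) = 0" by (simp add: inner_diff_right)
  then show "u = v" by simp
qed (rule assms)

lemma gderiv_along_line:
  assumes "GDERIV g (a + s *\<^sub>R h) :> v"
  shows "((\<lambda>s. g (a + s *\<^sub>R h)) has_real_derivative h \<bullet> v) (at s)"
proof -
  have "((\<lambda>s. a + s *\<^sub>R h) has_derivative (\<lambda>s. s *\<^sub>R h)) (at s)"
    by (auto intro!: derivative_eq_intros)
  moreover have "(g has_derivative (\<lambda>h. h \<bullet> v)) (at (a + s *\<^sub>R h))"
    using assms by (simp add: gderiv_def)
  ultimately have "((\<lambda>s. g (a + s *\<^sub>R h)) has_derivative (\<lambda>s. s *\<^sub>R h \<bullet> v)) (at s)"
    by (rule has_derivative_compose)
  then show ?thesis
    by (simp add: has_field_derivative_def mult_commute_abs)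
qed

lemma convex_on_above_tangent:
  fixes g :: "'a::real_inner \<Rightarrow> real"
  assumes g: "convex_on S g" and "x \<in> S" "y \<in> S" and v: "GDERIV g y :> v"
  shows "g y + v \<bullet> (x - y) \<le> g x"
proof -
  have "((\<lambda>s. g (y + s *\<^sub>R (x - y))) has_real_derivative (x - y) \<bullet> v) (at 0)"
    using v by (intro gderiv_along_line) simp
  \<comment> \<open>Only the right-hand limit is taken: convexity bounds the difference quotient for
    \<open>s\<close> between 0 and 1, while for negative \<open>s\<close> the point may leave
    \<open>S\<close>.\<close>
  then have lim: "((\<lambda>s. (g (y + s *\<^sub>R (x - y)) - g y) / s) \<longlongrightarrow> (x - y) \<bullet> v) (at_right 0)"
    by (simp add: has_field_derivative_iff filterlim_at_split)
  have "\<forall>\<^sub>F s::real in at_right 0. s \<in> {0<..<1}"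
    by (rule eventually_at_right_real) simp
  then have "\<forall>\<^sub>F s in at_right 0. (g (y + s *\<^sub>R (x - y)) - g y) / s \<le> g x - g y"
  proof eventually_elim
    case (elim s)
    have "g ((1 - s) *\<^sub>R y + s *\<^sub>R x) \<le> (1 - s) * g y + s * g x"
      using assms elim by (intro convex_onD[OF g]) auto
    moreover have "(1 - s) *\<^sub>R y + s *\<^sub>R x = y + s *\<^sub>R (x - y)"
      by (simp add: algebra_simps)
    ultimately show ?case
      using elim by (simp add: field_simps)
  qed
  from tendsto_upperbound[OF lim this] show ?thesis
    by (simp add: inner_commute)
qed

lemma proper_fun_real:
  assumes "proper_fun g" "x \<in> edom g"
  shows "ereal (real_of_ereal (g x)) = g x"
  using assms by (cases "g x") (auto simp: proper_fun_def edom_def)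

lemma convex_epigraph_real:
  assumes "proper_fun g" "convex (ereal_epigraph g)"
  shows "convex_on (edom g) (\<lambda>x. real_of_ereal (g x))"
proof -
  have *: "g ((1 - t) *\<^sub>R x + t *\<^sub>R y)
      \<le> ereal ((1 - t) * real_of_ereal (g x) + t * real_of_ereal (g y))"
    if "x \<in> edom g" "y \<in> edom g" "0 \<le> t" "t \<le> 1" for x y t
  proof -
    have "(x, real_of_ereal (g x)) \<in> ereal_epigraph g" "(y, real_of_ereal (g y)) \<in> ereal_epigraph g"
      using that assms(1) by (simp_all add: ereal_epigraph_def proper_fun_real)
    then have "(1 - t) *\<^sub>R (x, real_of_ereal (g x)) + t *\<^sub>R (y, real_of_ereal (g y)) \<in> ereal_epigraph g"
      using that by (intro convexD[OF assms(2)]) auto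
    then show ?thesis by (simp add: ereal_epigraph_def)
  qed
  have conv: "convex (edom g)"
  proof (rule convexI)
    fix x y and u v :: real
    assume a: "x \<in> edom g" "y \<in> edom g" "0 \<le> u" "0 \<le> v" "u + v = 1"
    then have u: "u = 1 - v" by simp
    have "g (u *\<^sub>R x + v *\<^sub>R y) \<le> ereal (u * real_of_ereal (g x) + v * real_of_ereal (g y))"
      using a *[of x y v] unfolding u by simp
    also have "\<dots> < \<infinity>" by simp
    finally show "u *\<^sub>R x + v *\<^sub>R y \<in> edom g"
      by (simp add: edom_def)
  qed
  show ?thesis
  proof (rule convex_onI[OF _ conv])
    fix t :: real and x y
    assume a: "0 < t" "t < 1" "x \<in> edom g" "y \<in> edom g"
    then have "(1 - t) *\<^sub>R x + t *\<^sub>R y \<in> edom g"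
      by (intro convexD[OF conv]) auto
    then show "real_of_ereal (g ((1 - t) *\<^sub>R x + t *\<^sub>R y))
        \<le> (1 - t) * real_of_ereal (g x) + t * real_of_ereal (g y)"
      using *[of x y t] a by (metis assms(1) ereal_less_eq(3) less_imp_le proper_fun_real)
  qed
qed

lemma second_order_taylor:
  fixes c :: "'a::real_inner \<Rightarrow> real"
  assumes "convex S"
    and c: "\<And>w. w \<in> S \<Longrightarrow> GDERIV c w :> C w"
    and C: "\<And>w. w \<in> S \<Longrightarrow> (C has_derivative H w) (at w)"
    and "a \<in> S" "b \<in> S"
  shows "\<exists>\<zeta>\<in>S. c b - c a - C a \<bullet> (b - a) = ((b - a) \<bullet> H \<zeta> (b - a)) / 2"
proof -
  define h where "h = b - a"
  \<comment> \<open>\<open>diff\<close> lists the restriction of \<open>c\<close> to the line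
    through \<open>a\<close> and \<open>b\<close> and its first two derivatives.\<close>
  define diff where "diff m s = (if m = 0 then c (a + s *\<^sub>R h)
    else if m = 1 then h \<bullet> C (a + s *\<^sub>R h) else h \<bullet> H (a + s *\<^sub>R h) h)" for m :: nat and s :: real
  have mem: "a + s *\<^sub>R h \<in> S" if "0 \<le> s" "s \<le> 1" for s
  proof -
    have "(1 - s) *\<^sub>R a + s *\<^sub>R b \<in> S"
      using assms that by (intro convexD) auto
    then show ?thesis by (simp add: h_def algebra_simps)
  qed
  have "(diff m has_real_derivative diff (Suc m) s) (at s)" if "m < 2" "0 \<le> s" "s \<le> 1" for m s
  proof -
    consider "m = 0" | "m = 1" using \<open>m < 2\<close> by linarith
    then show ?thesis
    proof cases
      case 1
      then show ?thesis
        using gderiv_along_line[OF c[OF mem[OF that(2,3)]]] by (simp add: diff_def[abs_def])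
    next
      case 2
      have line: "((\<lambda>s. a + s *\<^sub>R h) has_derivative (\<lambda>s. s *\<^sub>R h)) (at s)"
        by (auto intro!: derivative_eq_intros)
      have "((\<lambda>s. h \<bullet> C (a + s *\<^sub>R h)) has_derivative (\<lambda>r. h \<bullet> H (a + s *\<^sub>R h) (r *\<^sub>R h))) (at s)"
        by (rule has_derivative_inner_right[OF has_derivative_compose[OF line C[OF mem[OF that(2,3)]]]])
      moreover have "linear (H (a + s *\<^sub>R h))"
        using C[OF mem[OF that(2,3)]] by (rule has_derivative_linear)
      ultimately show ?thesis
        using 2 by (simp add: diff_def[abs_def] has_field_derivative_def linear_cmul mult_commute_abs)
    qed
  qed
  then obtain s where s: "0 < s" "s < 1"
    and eq: "diff 0 1 = (\<Sum>m<2. diff m 0 / fact m * (1 - 0) ^ m) + diff 2 s / fact 2 * (1 - 0)\<^sup>2"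
    using Taylor_up[of 2 diff "diff 0" 0 1 0] by auto
  have "c b - c a - C a \<bullet> h = (h \<bullet> H (a + s *\<^sub>R h) h) / 2"
    using eq by (simp add: diff_def numeral_2_eq_2 h_def inner_commute)
  then show ?thesis
    using mem[of s] s by (auto simp: h_def)
qed

lemma distortion_ratio:
  assumes def: "distortion_defined g \<Omega>" and le: "distortion g \<Omega> \<le> ereal \<rho>"
    and w: "w1 \<in> \<Omega>" "w2 \<in> \<Omega>"
  shows "\<xi> \<bullet> hessian g w2 \<xi> \<le> \<rho>\<^sup>2 * (\<xi> \<bullet> hessian g w1 \<xi>)"
proof (cases "\<xi> = 0")
  case False
  have pos: "0 < \<xi> \<bullet> hessian g w1 \<xi>" "0 < \<xi> \<bullet> hessian g w2 \<xi>"
    using def w False by (auto simp: distortion_defined_def)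
  have "ereal (sqrt (\<xi> \<bullet> hessian g w2 \<xi> / (\<xi> \<bullet> hessian g w1 \<xi>))) \<le> distortion g \<Omega>"
    unfolding distortion_def
    using False by (intro SUP_upper2[OF w(1)] SUP_upper2[OF w(2)] SUP_upper2[of \<xi>]) auto
  then have "sqrt (\<xi> \<bullet> hessian g w2 \<xi> / (\<xi> \<bullet> hessian g w1 \<xi>)) \<le> \<rho>"
    using le order_trans by fastforce
  then have "\<xi> \<bullet> hessian g w2 \<xi> / (\<xi> \<bullet> hessian g w1 \<xi>) \<le> \<rho>\<^sup>2"
    by (rule sqrt_le_D)
  then show ?thesis using pos by (simp add: field_simps)
qed simp

text \<open>Taking both base points equal to \<open>w\<close> makes the ratio of the Hessian forms
  1.\<close>

lemma distortion_ge_1: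
  fixes g :: "'a::euclidean_space \<Rightarrow> ereal"
  assumes "distortion_defined g \<Omega>" "distortion g \<Omega> \<le> ereal \<rho>" "w \<in> \<Omega>"
  shows "1 \<le> \<rho>"
proof -
  obtain \<xi> :: 'a where "\<xi> \<noteq> 0"
    using nonempty_Basis nonzero_Basis by blast
  then have "ereal (sqrt (\<xi> \<bullet> hessian g w \<xi> / (\<xi> \<bullet> hessian g w \<xi>))) \<le> distortion g \<Omega>"
    unfolding distortion_def using \<open>\<xi> \<noteq> 0\<close>
    by (intro SUP_upper2[OF assms(3)] SUP_upper2[of \<xi>]) auto
  moreover have "0 < \<xi> \<bullet> hessian g w \<xi>"
    using assms(1,3) \<open>\<xi> \<noteq> 0\<close> by (auto simp: distortion_defined_def)
  ultimately have "ereal 1 \<le> distortion g \<Omega>" by simp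
  from order_trans[OF this assms(2)] show ?thesis by simp
qed

lemma is_arg_min_arg_min:
  assumes "\<exists>x. is_arg_min F P x"
  shows "is_arg_min F P (arg_min F P)"
  unfolding arg_min_def using assms by (rule someI_ex)

section \<open>Bregman divergence of a Legendre function\<close>

locale bregman_problem =
  fixes d :: "real^'n \<Rightarrow> ereal" and f :: "real^'n \<Rightarrow> real" and \<mu> L :: real and x0 :: "real^'n"
  assumes legendre: "legendre d"
    and bij: "bij_betw (egradient d) (interior (edom d)) (interior (edom (conjugate d)))"
    and inverse_grad: "\<And>x. x \<in> interior (edom d) \<Longrightarrow> egradient (conjugate d) (egradient d x) = x"
    and x0: "x0 \<in> interior (edom d)"
    and f_convex: "convex_on (closure (edom d)) f"
    and f_diff: "\<And>x. x \<in> interior (closure (edom d)) \<Longrightarrow> \<exists>v. GDERIV f x :> v"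
    and f_smooth: "relatively_smooth (L - \<mu>) d (interior (closure (edom d))) f"
    and \<mu>_nonneg: "0 \<le> \<mu>" and \<mu>_less: "\<mu> < L"
    and conj_diff: "\<And>w. w \<in> interior (edom (conjugate d)) \<Longrightarrow> twice_differentiable_at (conjugate d) w"
begin

abbreviation "U \<equiv> interior (edom d)"
abbreviation "G \<equiv> egradient d"
abbreviation "\<delta> x \<equiv> real_of_ereal (d x)"
abbreviation "D \<equiv> breg d"
abbreviation "\<phi> \<equiv> phi d f \<mu> x0"
abbreviation "g\<phi> \<equiv> grad_phi d f \<mu> x0"

lemma proper: "proper_fun d" and epi_convex: "convex (ereal_epigraph d)"
  and d_gderiv_ex: "x \<in> U \<Longrightarrow> \<exists>v. GDERIV \<delta> x :> v"
  using legendre by (auto simp: legendre_def)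

lemma d_convex: "convex_on (edom d) \<delta>"
  by (rule convex_epigraph_real[OF proper epi_convex])

lemma convex_U: "convex U"
  using d_convex by (auto simp: convex_on_def intro: convex_interior)

lemma U_edom: "x \<in> U \<Longrightarrow> x \<in> edom d"
  using interior_subset by blast

lemma U_closure: "x \<in> U \<Longrightarrow> x \<in> closure (edom d)"
  using U_edom closure_subset by blast

lemma U_interior_closure: "x \<in> U \<Longrightarrow> x \<in> interior (closure (edom d))"
  using interior_mono[OF closure_subset] by blast

lemma d_real: "x \<in> edom d \<Longrightarrow> d x = ereal (\<delta> x)"
  using proper_fun_real[OF proper] by simp

lemma d_gderiv: "x \<in> U \<Longrightarrow> GDERIV \<delta> x :> G x"
  using d_gderiv_ex[of x] by (auto simp: egradient_def gderiv_gradient)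

lemma bregman_real:
  assumes "x \<in> edom d" "y \<in> U"
  shows "bregman d x y = ereal (\<delta> x - \<delta> y - G y \<bullet> (x - y))"
proof -
  obtain r s where "d x = ereal r" "d y = ereal s"
    using assms d_real U_edom by blast
  then show ?thesis by (simp add: bregman_def)
qed

lemma D_eq: "x \<in> edom d \<Longrightarrow> y \<in> U \<Longrightarrow> D x y = \<delta> x - \<delta> y - G y \<bullet> (x - y)"
  by (simp add: bregman_real)

lemma D_nonneg: "x \<in> edom d \<Longrightarrow> y \<in> U \<Longrightarrow> 0 \<le> D x y"
  using convex_on_above_tangent[OF d_convex _ U_edom d_gderiv, of x y] by (simp add: D_eq)

lemma D_self [simp]: "x \<in> U \<Longrightarrow> D x x = 0"
  by (simp add: D_eq U_edom)

lemma three_point: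
  assumes "x \<in> U" "y \<in> U" "z \<in> U"
  shows "D x z = D x y + D y z + (G y - G z) \<bullet> (x - y)"
  using assms by (simp add: D_eq U_edom algebra_simps inner_diff_left inner_diff_right)

section \<open>Gradient of the objective and its bounds relative to the divergence\<close>

lemma objective_real: "x \<in> U \<Longrightarrow> objective d f \<mu> x0 x = ereal (f x + \<mu> * D x x0)"
  by (simp add: objective_def bregman_real U_edom x0)

lemma phi_eq: "x \<in> U \<Longrightarrow> \<phi> x = f x + \<mu> * D x x0"
  by (simp add: objective_real)

lemma f_gderiv: "x \<in> U \<Longrightarrow> GDERIV f x :> gradient f x"
  using f_diff[OF U_interior_closure] gderiv_gradient by blast

text \<open>The objective and both subproblems have this form, with \<open>h\<close> equal to
  \<open>f\<close> or linear. The divergence is written out because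
  \<open>real_of_ereal (bregman d u y)\<close> agrees with the formula in general only on
  \<open>edom d\<close>.\<close>

lemma linear_plus_D_gderiv:
  assumes "x \<in> U" "y \<in> U" "GDERIV h x :> v"
  shows "GDERIV (\<lambda>u. h u + a * (\<delta> u - \<delta> y - G y \<bullet> (u - y))) x :> v + a *\<^sub>R (G x - G y)"
proof -
  have "(h has_derivative (\<lambda>k. k \<bullet> v)) (at x)" "(\<delta> has_derivative (\<lambda>k. k \<bullet> G x)) (at x)"
    using assms d_gderiv by (simp_all add: gderiv_def)
  then show ?thesis
    unfolding gderiv_def
    by (auto intro!: derivative_eq_intros simp: algebra_simps inner_diff_right inner_add_right inner_commute)
qed

lemma phi_gderiv:
  assumes "x \<in> U"
  shows "GDERIV \<phi> x :> gradient f x + \<mu> *\<^sub>R (G x - G x0)"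
proof -
  let ?h = "\<lambda>u. f u + \<mu> * (\<delta> u - \<delta> x0 - G x0 \<bullet> (u - x0))"
  have eq: "?h u = \<phi> u" if "u \<in> U" for u
    using that by (simp add: objective_real D_eq U_edom x0)
  have "(?h has_derivative (\<lambda>k. k \<bullet> (gradient f x + \<mu> *\<^sub>R (G x - G x0)))) (at x)"
    using linear_plus_D_gderiv[OF assms x0 f_gderiv[OF assms]] by (simp add: gderiv_def)
  from has_derivative_transform_within_open[OF this open_interior assms eq]
  show ?thesis unfolding gderiv_def .
qed

lemma grad_phi_eq: "x \<in> U \<Longrightarrow> g\<phi> x = gradient f x + \<mu> *\<^sub>R (G x - G x0)"
  using gderiv_gradient[OF phi_gderiv] by (simp add: egradient_def)

lemma f_above_tangent: "x \<in> U \<Longrightarrow> y \<in> U \<Longrightarrow> f y + gradient f y \<bullet> (x - y) \<le> f x"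
  by (intro convex_on_above_tangent[OF f_convex] U_closure f_gderiv)

text \<open>By the three-point identity the regularizer contributes exactly
  \<open>\<mu> * D x y\<close>, whatever \<open>x0\<close> is. Convexity and relative smoothness of
  \<open>f\<close> thus become bounds on \<phi> with the constants \<mu> and
  \<open>L\<close>.\<close>

lemma phi_gap:
  assumes "x \<in> U" "y \<in> U"
  shows "\<phi> x - \<phi> y - g\<phi> y \<bullet> (x - y) = f x - f y - gradient f y \<bullet> (x - y) + \<mu> * D x y"
  unfolding phi_eq[OF assms(1)] phi_eq[OF assms(2)] grad_phi_eq[OF assms(2)] three_point[OF assms x0]
  by (simp add: inner_add_left algebra_simps)

lemma phi_lower:
  assumes "x \<in> U" "y \<in> U"
  shows "\<phi> y + g\<phi> y \<bullet> (x - y) + \<mu> * D x y \<le> \<phi> x"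
  using phi_gap[OF assms] f_above_tangent[OF assms] by simp

lemma phi_upper:
  assumes "x \<in> U" "y \<in> U"
  shows "\<phi> x \<le> \<phi> y + g\<phi> y \<bullet> (x - y) + L * D x y"
proof -
  have "ereal (f x - f y - gradient f y \<bullet> (x - y)) \<le> ereal (L - \<mu>) * bregman d x y"
    using f_smooth assms U_interior_closure unfolding relatively_smooth_def by blast
  then have "f x - f y - gradient f y \<bullet> (x - y) \<le> (L - \<mu>) * D x y"
    using assms by (simp add: bregman_real U_edom)
  then show ?thesis
    using phi_gap[OF assms] by (simp add: algebra_simps)
qed

text \<open>The common optimality condition of the gradient step and the \<open>z\<close> step.
  Existence makes \<open>arg_min\<close> an actual minimizer; interiority makes the derivative
  vanish there.\<close>

lemma D_linear_arg_min:
  assumes F: "\<And>u. F u = ereal (v \<bullet> u) + ereal a * bregman d u y"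
    and "minimizers_interior d UNIV F" and y: "y \<in> U"
  shows "arg_min F (\<lambda>x. x \<in> UNIV) \<in> U"
    and "v + a *\<^sub>R (G (arg_min F (\<lambda>x. x \<in> UNIV)) - G y) = 0"
proof -
  define x where "x = arg_min F (\<lambda>x. x \<in> UNIV)"
  have min: "is_arg_min F (\<lambda>x. x \<in> UNIV) x"
    unfolding x_def using assms(2) by (intro is_arg_min_arg_min) (simp add: minimizers_interior_def)
  then show x: "arg_min F (\<lambda>x. x \<in> UNIV) \<in> U"
    using assms(2) by (simp add: minimizers_interior_def x_def)
  let ?h = "\<lambda>u. v \<bullet> u + a * (\<delta> u - \<delta> y - G y \<bullet> (u - y))"
  have F_real: "F u = ereal (?h u)" if "u \<in> U" for u
    using that y by (simp add: F bregman_real U_edom)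
  have "?h x \<le> ?h u" if "u \<in> U" for u
  proof -
    have "F x \<le> F u" using min by (auto simp: is_arg_min_def not_less)
    then show ?thesis using F_real that x by (simp add: x_def)
  qed
  moreover have "GDERIV (\<lambda>u. v \<bullet> u) x :> v"
    unfolding gderiv_def by (auto intro!: derivative_eq_intros simp: inner_commute)
  then have "GDERIV ?h x :> v + a *\<^sub>R (G x - G y)"
    using x y by (intro linear_plus_D_gderiv) (simp_all add: x_def)
  ultimately have "(\<lambda>k. k \<bullet> (v + a *\<^sub>R (G x - G y))) = (\<lambda>k. 0)"
    using x unfolding gderiv_def by (intro differential_zero_maxmin[of x U ?h]) (auto simp: x_def)
  then have "(v + a *\<^sub>R (G x - G y)) \<bullet> (v + a *\<^sub>R (G x - G y)) = 0"
    by meson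
  then show "v + a *\<^sub>R (G (arg_min F (\<lambda>x. x \<in> UNIV)) - G y) = 0"
    by (simp add: x_def)
qed

section \<open>Divergences of \<open>d\<close> as divergences of its conjugate\<close>

lemma conjugate_grad:
  assumes "x \<in> U"
  shows "conjugate d (G x) = ereal (G x \<bullet> x - \<delta> x)"
  unfolding conjugate_def
proof (rule antisym[OF SUP_least SUP_upper2[of x]])
  fix y
  show "ereal (G x \<bullet> y) - d y \<le> ereal (G x \<bullet> x - \<delta> x)"
  proof (cases "y \<in> edom d")
    case True
    then have "\<delta> x + G x \<bullet> (y - x) \<le> \<delta> y"
      using convex_on_above_tangent[OF d_convex _ U_edom d_gderiv] assms by blast
    moreover obtain r where "d y = ereal r"
      using d_real[OF True] by blast
    ultimately show ?thesis
      by (simp add: inner_diff_right)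
  next
    case False
    then show ?thesis by (simp add: edom_def)
  qed
next
  obtain r where "d x = ereal r"
    using d_real[OF U_edom[OF assms]] by blast
  then show "ereal (G x \<bullet> x - \<delta> x) \<le> ereal (G x \<bullet> x) - d x"
    by simp
qed simp

abbreviation "dual_bregman b a \<equiv>
  real_of_ereal (conjugate d b) - real_of_ereal (conjugate d a) - egradient (conjugate d) a \<bullet> (b - a)"

text \<open>Fenchel's equality at \<open>G x\<close> and \<open>G y\<close>, with the gradient of
  the conjugate inverting \<open>G\<close>; the two arguments swap roles.\<close>

lemma D_dual: "x \<in> U \<Longrightarrow> y \<in> U \<Longrightarrow> D x y = dual_bregman (G y) (G x)"
  by (simp add: D_eq U_edom conjugate_grad inverse_grad inner_diff_right inner_commute[of x])

lemma grad_dual: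
  assumes "w \<in> interior (edom (conjugate d))"
  shows "egradient (conjugate d) w \<in> U" "G (egradient (conjugate d) w) = w"
proof -
  obtain x where "x \<in> U" "w = G x"
    using bij assms by (auto simp: bij_betw_def)
  then show "egradient (conjugate d) w \<in> U" "G (egradient (conjugate d) w) = w"
    by (simp_all add: inverse_grad)
qed

text \<open>Both dual segments are multiples of one direction \<xi>, so Taylor's formula writes
  \<open>D p q\<close> and \<open>D p' q'\<close> as \<open>a\<^sup>2 / 2\<close> and
  \<open>b\<^sup>2 / 2\<close> times Hessian forms at \<xi>, which differ at most by the factor
  \<open>\<rho>\<^sup>2\<close>. Nothing is divided by \<open>a\<close> or \<open>b\<close>, so
  either may vanish.\<close>

lemma D_compare:
  assumes "convex \<Omega>" and def: "distortion_defined (conjugate d) \<Omega>"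
    and dist: "distortion (conjugate d) \<Omega> \<le> ereal \<rho>"
    and U: "p \<in> U" "q \<in> U" "p' \<in> U" "q' \<in> U"
    and \<Omega>: "G p \<in> \<Omega>" "G q \<in> \<Omega>" "G p' \<in> \<Omega>" "G q' \<in> \<Omega>"
    and eq: "G q - G p = a *\<^sub>R \<xi>" "G q' - G p' = b *\<^sub>R \<xi>"
  shows "b\<^sup>2 * D p q \<le> \<rho>\<^sup>2 * a\<^sup>2 * D p' q'"
proof -
  let ?H = "hessian (conjugate d)"
  have int: "\<Omega> \<subseteq> interior (edom (conjugate d))"
    using def by (simp add: distortion_defined_def)
  then have diff: "twice_differentiable_at (conjugate d) w" if "w \<in> \<Omega>" for w
    using conj_diff that by blast
  have c: "GDERIV (\<lambda>w. real_of_ereal (conjugate d w)) w :> egradient (conjugate d) w" if "w \<in> \<Omega>" for w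
    using diff[OF that] by (auto simp: twice_differentiable_at_def egradient_def gderiv_gradient)
  have C: "(egradient (conjugate d) has_derivative ?H w) (at w)" if "w \<in> \<Omega>" for w
    using diff[OF that] by (simp add: twice_differentiable_at_def hessian_def frechet_derivative_works)
  have taylor: "\<exists>\<zeta>\<in>\<Omega>. D x y = s\<^sup>2 * (\<xi> \<bullet> ?H \<zeta> \<xi>) / 2"
    if xy: "x \<in> U" "y \<in> U" "G x \<in> \<Omega>" "G y \<in> \<Omega>" "G y - G x = s *\<^sub>R \<xi>" for x y s
  proof -
    obtain \<zeta> where \<zeta>: "\<zeta> \<in> \<Omega>" "dual_bregman (G y) (G x) = ((G y - G x) \<bullet> ?H \<zeta> (G y - G x)) / 2"
      using second_order_taylor[OF assms(1) c C xy(3,4)] by blast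
    have "linear (?H \<zeta>)" using C[OF \<zeta>(1)] by (rule has_derivative_linear)
    then have "(s *\<^sub>R \<xi>) \<bullet> ?H \<zeta> (s *\<^sub>R \<xi>) = s\<^sup>2 * (\<xi> \<bullet> ?H \<zeta> \<xi>)"
      by (simp add: linear_cmul power2_eq_square)
    then show ?thesis
      using \<zeta> D_dual[OF xy(1,2)] unfolding xy(5) by auto
  qed
  obtain \<zeta> where \<zeta>: "\<zeta> \<in> \<Omega>" "D p q = a\<^sup>2 * (\<xi> \<bullet> ?H \<zeta> \<xi>) / 2"
    using taylor[OF U(1,2) \<Omega>(1,2) eq(1)] by blast
  obtain \<zeta>' where \<zeta>': "\<zeta>' \<in> \<Omega>" "D p' q' = b\<^sup>2 * (\<xi> \<bullet> ?H \<zeta>' \<xi>) / 2"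
    using taylor[OF U(3,4) \<Omega>(3,4) eq(2)] by blast
  have "(b\<^sup>2 * a\<^sup>2 / 2) * (\<xi> \<bullet> ?H \<zeta> \<xi>) \<le> (b\<^sup>2 * a\<^sup>2 / 2) * (\<rho>\<^sup>2 * (\<xi> \<bullet> ?H \<zeta>' \<xi>))"
    using distortion_ratio[OF def dist \<zeta>'(1) \<zeta>(1)] by (intro mult_left_mono) auto
  then show ?thesis
    unfolding \<zeta>(2) \<zeta>'(2) by (simp add: algebra_simps)
qed

end

section \<open>A single trial\<close>

text \<open>The formula is the positive root of \<open>M * t\<^sup>2 + e * t - (e + \<mu>)\<close>,
  rationalized. At 1 this quadratic equals \<open>M - \<mu> > 0\<close>, so the root lies below
  1.\<close>

lemma step_size_equation:
  fixes e \<mu> M t :: real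
  assumes "0 < e" "0 \<le> \<mu>" "\<mu> < M" and t: "t = 2 * (e + \<mu>) / (e + sqrt (e\<^sup>2 + 4 * M * (e + \<mu>)))"
  shows "0 < t" "t < 1" "M * t\<^sup>2 = (1 - t) * e + \<mu>"
proof -
  define q where "q = sqrt (e\<^sup>2 + 4 * M * (e + \<mu>))"
  have q: "q\<^sup>2 = e\<^sup>2 + 4 * M * (e + \<mu>)" "0 \<le> q"
    using assms by (simp_all add: q_def)
  have t_q: "t * (e + q) = 2 * (e + \<mu>)"
    using assms q(2) by (simp add: t q_def[symmetric])
  show "0 < t"
    using assms q(2) by (simp add: t q_def[symmetric])
  have "(q - e) * (e + q) = 2 * M * (2 * (e + \<mu>))"
    using q(1) by (simp add: algebra_simps power2_eq_square)
  then have "(q - e) * (e + q) = 2 * M * t * (e + q)"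
    by (simp only: t_q[symmetric] mult.assoc)
  moreover have "e + q \<noteq> 0"
    using assms q(2) by simp
  ultimately have "2 * M * t = q - e"
    by (metis mult_right_cancel)
  then have "2 * (M * t\<^sup>2) = t * (q - e)"
    by (metis mult.assoc mult.commute power2_eq_square)
  then show eq: "M * t\<^sup>2 = (1 - t) * e + \<mu>"
    using t_q by (simp add: algebra_simps)
  show "t < 1"
  proof (rule ccontr)
    assume "\<not> t < 1"
    then have "1 \<le> t\<^sup>2" "(1 - t) * e \<le> 0"
      using assms(1) by (simp_all add: mult_nonpos_nonneg)
    then have "M * 1 \<le> \<mu>"
      using eq assms mult_left_mono[of 1 "t\<^sup>2" M] by linarith
    then show False using assms by simp
  qed
qed

section \<open>Gradient step with backtracking, and the invariant of the run\<close>

context bregman_problem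
begin

lemma x_step_interior:
  assumes "minimizers_interior d UNIV (x_subproblem d f \<mu> x0 y Lnew)" "y \<in> U"
  shows "x_step d f \<mu> x0 y Lnew \<in> U"
    and "g\<phi> y + Lnew *\<^sub>R (G (x_step d f \<mu> x0 y Lnew) - G y) = 0"
  using D_linear_arg_min[OF x_subproblem_def assms] by (simp_all add: x_step_def)

lemma x_step_ok_ge_L:
  assumes "minimizers_interior d UNIV (x_subproblem d f \<mu> x0 y Lnew)" "y \<in> U" "L \<le> Lnew"
  shows "x_step_ok d f \<mu> x0 y Lnew"
proof -
  let ?x = "x_step d f \<mu> x0 y Lnew"
  have x: "?x \<in> U" using assms(1,2) by (rule x_step_interior)
  have "L * D ?x y \<le> Lnew * D ?x y"
    using x assms(2,3) D_nonneg[OF U_edom] by (intro mult_right_mono) auto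
  then show ?thesis
    unfolding x_step_ok_def Let_def using phi_upper[OF x assms(2)] by linarith
qed

text \<open>Values from \<open>L\<close> on pass the descent test, so the search ends. After at
  least one doubling the previous value has failed, so it was below \<open>L\<close>.\<close>

lemma backtrack_succeeds:
  assumes y: "y \<in> U" and "0 < Lo"
    and solv: "\<And>i. (\<And>i'. i' < i \<Longrightarrow> \<not> x_step_ok d f \<mu> x0 y (Lo * 2 ^ i'))
        \<Longrightarrow> minimizers_interior d UNIV (x_subproblem d f \<mu> x0 y (Lo * 2 ^ i))"
  obtains i where "backtrack d f \<mu> x0 y Lo = Lo * 2 ^ i"
    and "x_step_ok d f \<mu> x0 y (Lo * 2 ^ i)"
    and "minimizers_interior d UNIV (x_subproblem d f \<mu> x0 y (Lo * 2 ^ i))"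
    and "0 < i \<Longrightarrow> Lo * 2 ^ i < 2 * L"
proof -
  let ?ok = "\<lambda>i. x_step_ok d f \<mu> x0 y (Lo * 2 ^ i)"
  have ex: "\<exists>i. ?ok i"
  proof (rule ccontr)
    assume none: "\<nexists>i. ?ok i"
    obtain i where "L / Lo < 2 ^ i" using real_arch_pow[of 2 "L / Lo"] by auto
    then have "L \<le> Lo * 2 ^ i" using \<open>0 < Lo\<close> by (simp add: field_simps)
    \<comment> \<open>Without any success all earlier tests fail, which is the premise under which
      \<open>solv\<close> provides minimizers.\<close>
    then have "?ok i" using none y by (intro x_step_ok_ge_L solv) auto
    then show False using none by blast
  qed
  define i where "i = (LEAST i. ?ok i)"
  have ok: "?ok i" unfolding i_def using ex by (rule LeastI_ex)
  have min: "\<not> ?ok i'" if "i' < i" for i' using that not_less_Least unfolding i_def by blast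
  show ?thesis
  proof (rule that[of i])
    show "backtrack d f \<mu> x0 y Lo = Lo * 2 ^ i"
      by (simp add: backtrack_def i_def)
    show "minimizers_interior d UNIV (x_subproblem d f \<mu> x0 y (Lo * 2 ^ i))"
      using min by (rule solv)
    show "Lo * 2 ^ i < 2 * L" if "0 < i"
    proof -
      obtain i' where i': "i = Suc i'" using \<open>0 < i\<close> gr0_implies_Suc by blast
      have "\<not> L \<le> Lo * 2 ^ i'"
        using x_step_ok_ge_L[OF solv y, of i'] min i' by force
      then show ?thesis by (simp add: i')
    qed
  qed (rule ok)
qed

text \<open>An estimate sequence: an affine minorant of \<open>f\<close> with slope
  \<open>st_lambda s\<close>, whose regularized value at \<open>st_z s\<close> dominates the best
  value found. The algorithm does not compute \<open>A\<close>, hence the quantifier.\<close>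

definition estimate :: "(real^'n) abra_state \<Rightarrow> bool" where
  "estimate s \<longleftrightarrow> (\<exists>A.
     st_phibest s \<le> A + st_lambda s \<bullet> st_z s + (\<mu> + inverse (st_eta s)) * D (st_z s) x0 \<and>
     (\<forall>u\<in>U. A + st_lambda s \<bullet> u \<le> f u))"

text \<open>At \<open>k = 0\<close> the field \<open>st_eta\<close> is 0 in place of an infinite
  inverse, so the estimate and the optimality condition of \<open>st_z s\<close> are demanded only
  from \<open>k = 1\<close> on; the initial values of \<open>st_z\<close> and
  \<open>st_lambda\<close> take their place.\<close>

definition valid_state :: "nat \<Rightarrow> (real^'n) abra_state \<Rightarrow> bool" where
  "valid_state k s \<longleftrightarrow>
     st_xbest s \<in> U \<and> st_z s \<in> U \<and> st_phibest s = \<phi> (st_xbest s) \<and> 0 < st_M s \<and> 0 < st_L s \<and>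
     (k = 0 \<longrightarrow> st_z s = x0 \<and> st_lambda s = 0) \<and>
     (k > 0 \<longrightarrow> 0 < st_eta s \<and> estimate s \<and>
        st_lambda s + (\<mu> + inverse (st_eta s)) *\<^sub>R (G (st_z s) - G x0) = 0)"

end

text \<open>The starting values \<open>Mo\<close>, \<open>Lo\<close>, \<open>pb\<close>,
  \<open>xb\<close> are kept general, which covers first and later trials of an inner loop
  alike.\<close>

locale abra_step = bregman_problem d f \<mu> L x0
  for d :: "real^'n \<Rightarrow> ereal" and f \<mu> L x0 +
  fixes k :: nat and s :: "(real^'n) abra_state" and Mo Lo pb :: real and xb :: "real^'n" and r
  assumes r_def: "r = trial d f \<mu> x0 k s Mo Lo pb xb"
    and s_valid: "valid_state k s"
    and Mo: "\<mu> \<le> Mo" "0 < Mo" and Lo: "\<mu> \<le> Lo" "0 < Lo"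
    and xb: "xb \<in> U" "pb = \<phi> xb"
    and x_solvable: "\<And>i. (\<And>i'. i' < i \<Longrightarrow> \<not> x_step_ok d f \<mu> x0 (st_y r) (Lo * 2 ^ i'))
        \<Longrightarrow> minimizers_interior d UNIV (x_subproblem d f \<mu> x0 (st_y r) (Lo * 2 ^ i))"
    and z_solvable: "minimizers_interior d UNIV (z_subproblem d \<mu> x0 (st_lambda r) (st_eta r))"
begin

abbreviation "M \<equiv> st_M r"
abbreviation "e \<equiv> inverse (st_eta s)"
abbreviation "t \<equiv> st_t r"
abbreviation "\<tau> \<equiv> st_tau r"
abbreviation "y \<equiv> st_y r"
abbreviation "z \<equiv> st_z s"
abbreviation "x' \<equiv> st_xnext r"
abbreviation "z' \<equiv> st_z r"
abbreviation "e' \<equiv> inverse (st_eta r)"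
abbreviation "Lnew \<equiv> st_L r"
text \<open>Built from \<open>Lo\<close>, the estimate before the backtracking, because
  \<open>y\<close> is computed before \<open>Lnew\<close> is known.\<close>

definition "\<theta> = \<mu> / sqrt (M * Lo)"

lemma trial_fields:
  "M = 2 * Mo"
  "t = (if k = 0 then 1 else min 1 (2 * (e + \<mu>) / (e + sqrt (e\<^sup>2 + 4 * M * (e + \<mu>)))))"
  "e' = M * t\<^sup>2 - \<mu>"
  "\<tau> = (t - \<theta>) / (1 - \<theta>)"
  "y = (1 - \<tau>) *\<^sub>R st_xbest s + \<tau> *\<^sub>R z"
  "st_philow r = \<phi> y + g\<phi> y \<bullet> (z - y) + \<mu> * D z y"
  "Lnew = backtrack d f \<mu> x0 y Lo"
  "x' = x_step d f \<mu> x0 y Lnew"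
  "st_lambda r = (1 - t) *\<^sub>R st_lambda s + t *\<^sub>R (g\<phi> y - \<mu> *\<^sub>R (G y - G x0))"
  "z' = z_step d \<mu> x0 (st_lambda r) (st_eta r)"
  "st_Lin r = Lo"
  "st_phibest r = (if pb > \<phi> x' then \<phi> x' else pb)"
  "st_xbest r = (if pb > \<phi> x' then x' else xb)"
proof -
  define m where "m = 2 * Mo"
  define t1 where "t1 = (if k = 0 then 1 else min 1 (2 * (e + \<mu>) / (e + sqrt (e\<^sup>2 + 4 * m * (e + \<mu>)))))"
  define \<eta>1 where "\<eta>1 = inverse (m * t1\<^sup>2 - \<mu>)"
  define \<theta>1 where "\<theta>1 = \<mu> / sqrt (m * Lo)"
  define \<tau>1 where "\<tau>1 = (t1 - \<theta>1) / (1 - \<theta>1)"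
  define y1 where "y1 = (1 - \<tau>1) *\<^sub>R st_xbest s + \<tau>1 *\<^sub>R z"
  define p1 where "p1 = \<phi> y1 + g\<phi> y1 \<bullet> (z - y1) + \<mu> * D z y1"
  define l1 where "l1 = backtrack d f \<mu> x0 y1 Lo"
  define x1 where "x1 = x_step d f \<mu> x0 y1 l1"
  define lam1 where "lam1 = (1 - t1) *\<^sub>R st_lambda s + t1 *\<^sub>R (g\<phi> y1 - \<mu> *\<^sub>R (G y1 - G x0))"
  define z1 where "z1 = z_step d \<mu> x0 lam1 \<eta>1"
  have r: "r = \<lparr>st_M = m, st_L = l1,
         st_phibest = (if pb > \<phi> x1 then \<phi> x1 else pb),
         st_xbest = (if pb > \<phi> x1 then x1 else xb),
         st_z = z1, st_lambda = lam1, st_eta = \<eta>1,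
         st_Lin = Lo, st_t = t1, st_tau = \<tau>1, st_y = y1, st_philow = p1, st_xnext = x1\<rparr>"
    unfolding r_def trial_def Let_def z1_def lam1_def x1_def l1_def p1_def y1_def \<tau>1_def \<theta>1_def
      \<eta>1_def t1_def m_def by (rule refl)
  have fields: "st_M r = m" "st_L r = l1" "st_phibest r = (if pb > \<phi> x1 then \<phi> x1 else pb)"
    "st_xbest r = (if pb > \<phi> x1 then x1 else xb)" "st_z r = z1" "st_lambda r = lam1" "st_eta r = \<eta>1"
    "st_Lin r = Lo" "st_t r = t1" "st_tau r = \<tau>1" "st_y r = y1" "st_philow r = p1" "st_xnext r = x1"
    unfolding r by simp_all
  show "M = 2 * Mo"
    "t = (if k = 0 then 1 else min 1 (2 * (e + \<mu>) / (e + sqrt (e\<^sup>2 + 4 * M * (e + \<mu>)))))"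
    "\<tau> = (t - \<theta>) / (1 - \<theta>)"
    "y = (1 - \<tau>) *\<^sub>R st_xbest s + \<tau> *\<^sub>R z"
    "st_philow r = \<phi> y + g\<phi> y \<bullet> (z - y) + \<mu> * D z y"
    "Lnew = backtrack d f \<mu> x0 y Lo"
    "x' = x_step d f \<mu> x0 y Lnew"
    "st_lambda r = (1 - t) *\<^sub>R st_lambda s + t *\<^sub>R (g\<phi> y - \<mu> *\<^sub>R (G y - G x0))"
    "z' = z_step d \<mu> x0 (st_lambda r) (st_eta r)"
    "st_Lin r = Lo"
    "st_phibest r = (if pb > \<phi> x' then \<phi> x' else pb)"
    "st_xbest r = (if pb > \<phi> x' then x' else xb)"
    unfolding fields \<theta>_def
    by (rule m_def t1_def \<tau>1_def[unfolded \<theta>1_def] y1_def p1_def l1_def x1_def lam1_def z1_def refl)+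
  show "e' = M * t\<^sup>2 - \<mu>"
    unfolding fields \<eta>1_def by simp
qed

section \<open>Step size and interpolation weight\<close>

lemma s_facts: "st_xbest s \<in> U" "z \<in> U" "st_phibest s = \<phi> (st_xbest s)"
  using s_valid by (auto simp: valid_state_def)

lemma M_bounds: "\<mu> < M" "0 < M"
  using Mo trial_fields(1) by auto

lemma e_pos: "k > 0 \<Longrightarrow> 0 < e"
  using s_valid by (simp add: valid_state_def)

lemma t_step:
  assumes "k > 0"
  shows "0 < t" "t < 1" "M * t\<^sup>2 = (1 - t) * e + \<mu>"
proof -
  note * = step_size_equation[OF e_pos[OF assms] \<mu>_nonneg M_bounds(1) refl]
  have "t = 2 * (e + \<mu>) / (e + sqrt (e\<^sup>2 + 4 * M * (e + \<mu>)))"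
    using * assms by (subst trial_fields(2)) simp
  with * show "0 < t" "t < 1" "M * t\<^sup>2 = (1 - t) * e + \<mu>" by metis+
qed

lemma t_first: "k = 0 \<Longrightarrow> t = 1"
  by (simp add: trial_fields(2))

lemma t_bounds: "0 < t" "t \<le> 1"
  using t_step t_first by (cases "k = 0"; force)+

lemma Mt: "\<mu> < M * t\<^sup>2"
  using t_step e_pos t_first M_bounds by (cases "k = 0") auto

lemma e'_pos: "0 < e'"
  using Mt trial_fields(3) by simp

lemma e'_step: "k > 0 \<Longrightarrow> e' = (1 - t) * e"
  using t_step trial_fields(3) by simp

text \<open>These bounds put \<tau> between 0 and 1, hence \<open>y\<close> into the convex set
  \<open>U\<close>. They come from multiplying \<open>\<mu> \<le> Lo\<close> with
  \<open>\<mu> < M\<close> and with \<open>\<mu> < M * t\<^sup>2\<close>.\<close>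

lemma \<theta>_bounds: "0 \<le> \<theta>" "\<theta> < 1" "\<theta> \<le> t"
proof -
  have pos: "0 < M * Lo" using M_bounds Lo by simp
  show "0 \<le> \<theta>" using \<mu>_nonneg pos by (simp add: \<theta>_def)
  have "\<mu>\<^sup>2 < M * Lo"
    using M_bounds Lo \<mu>_nonneg by (smt (verit, best) mult_le_cancel_left_pos mult_less_cancel_right_disj power2_eq_square)
  then have "\<mu> < sqrt (M * Lo)" by (rule real_less_rsqrt)
  then show "\<theta> < 1" using pos by (simp add: \<theta>_def)
  have "\<mu> * \<mu> \<le> (M * t\<^sup>2) * Lo"
    using Mt Lo \<mu>_nonneg by (intro mult_mono) auto
  then have "\<mu> \<le> sqrt (M * Lo * t\<^sup>2)"
    by (intro real_le_rsqrt) (simp add: power2_eq_square mult_ac)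
  then have "\<mu> \<le> t * sqrt (M * Lo)"
    using t_bounds by (simp add: real_sqrt_mult mult_ac)
  then show "\<theta> \<le> t" using pos by (simp add: \<theta>_def divide_le_eq)
qed

lemma \<tau>_bounds: "0 \<le> \<tau>" "\<tau> \<le> 1"
  using \<theta>_bounds t_bounds by (simp_all add: trial_fields(4))

lemma t_\<tau>: "t = \<theta> + \<tau> * (1 - \<theta>)"
  using \<theta>_bounds by (simp add: trial_fields(4))

lemma y_U: "y \<in> U"
  unfolding trial_fields(5) using \<tau>_bounds s_facts by (intro convexD[OF convex_U]) auto

lemma y_first: "k = 0 \<Longrightarrow> y = z"
  using \<theta>_bounds by (simp add: trial_fields(5) trial_fields(4) t_first)

section \<open>Optimality conditions of the two steps\<close>

lemma backtrack_cases:
  obtains i where "Lnew = Lo * 2 ^ i" "x_step_ok d f \<mu> x0 y Lnew"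
    "minimizers_interior d UNIV (x_subproblem d f \<mu> x0 y Lnew)" "0 < i \<Longrightarrow> Lnew < 2 * L"
proof -
  obtain i where "backtrack d f \<mu> x0 y Lo = Lo * 2 ^ i"
    "x_step_ok d f \<mu> x0 y (Lo * 2 ^ i)"
    "minimizers_interior d UNIV (x_subproblem d f \<mu> x0 y (Lo * 2 ^ i))"
    "0 < i \<Longrightarrow> Lo * 2 ^ i < 2 * L"
    using backtrack_succeeds[OF y_U Lo(2) x_solvable] by blast
  then show thesis using that[of i] trial_fields(7) by simp
qed

lemma Lnew_ge: "Lo \<le> Lnew"
proof -
  obtain i where "Lnew = Lo * 2 ^ i" using backtrack_cases by blast
  then show ?thesis using Lo(2) by simp
qed

lemma Lnew_pos: "0 < Lnew"
  using Lnew_ge Lo by simp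

lemma Lnew_le: "Lnew \<le> max Lo (2 * L)"
proof -
  obtain i where "Lnew = Lo * 2 ^ i" "0 < i \<Longrightarrow> Lnew < 2 * L" using backtrack_cases by blast
  then show ?thesis by (cases i) auto
qed

lemma x'_U: "x' \<in> U" and x'_grad: "g\<phi> y = Lnew *\<^sub>R (G y - G x')"
proof -
  have solv: "minimizers_interior d UNIV (x_subproblem d f \<mu> x0 y Lnew)"
    using backtrack_cases by blast
  from x_step_interior(1)[OF solv y_U] show "x' \<in> U"
    by (simp only: trial_fields(8))
  from x_step_interior(2)[OF solv y_U] have "g\<phi> y + Lnew *\<^sub>R (G x' - G y) = 0"
    by (simp only: trial_fields(8))
  then show "g\<phi> y = Lnew *\<^sub>R (G y - G x')"
    by (simp add: scaleR_diff_right add_eq_0_iff2)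
qed

lemma xbest_facts: "st_xbest r \<in> U" "st_phibest r = \<phi> (st_xbest r)" "st_phibest r \<le> \<phi> x'"
  unfolding trial_fields(12) trial_fields(13) using xb x'_U by auto

lemma z'_U: "z' \<in> U" and z'_opt: "st_lambda r + (M * t\<^sup>2) *\<^sub>R (G z' - G x0) = 0"
  using D_linear_arg_min[OF z_subproblem_def z_solvable x0] trial_fields(3)
  by (simp_all add: trial_fields(10) z_step_def)

text \<open>Combining the optimality conditions of \<open>z\<close> and \<open>z'\<close> eliminates
  \<open>st_lambda\<close> and \<open>x0\<close>; the old one enters with weight
  \<open>(1 - t) * (\<mu> + e) = M * t\<^sup>2 - t * \<mu>\<close>. For \<open>k = 0\<close> there
  is no old condition, but \<open>y = z = x0\<close>.\<close>

lemma z'_grad: "(M * t\<^sup>2) *\<^sub>R (G z' - G z) = t *\<^sub>R (\<mu> *\<^sub>R (G y - G z) - g\<phi> y)"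
proof (cases "k = 0")
  case True
  then have "z = x0" "st_lambda s = 0" "y = x0"
    using s_valid y_first by (auto simp: valid_state_def)
  then show ?thesis
    using z'_opt t_first[OF True] by (simp add: trial_fields(9) add_eq_0_iff)
next
  case False
  then have k: "k > 0" by simp
  have "st_lambda s = - ((\<mu> + e) *\<^sub>R (G z - G x0))"
    using s_valid k by (simp add: valid_state_def add_eq_0_iff2)
  moreover have "(1 - t) * (\<mu> + e) = M * t\<^sup>2 - t * \<mu>"
    using t_step(3)[OF k] by (simp add: algebra_simps)
  ultimately have lam: "(1 - t) *\<^sub>R st_lambda s = - ((M * t\<^sup>2 - t * \<mu>) *\<^sub>R (G z - G x0))"
    by simp
  have "(M * t\<^sup>2) *\<^sub>R (G z' - G z) - t *\<^sub>R (\<mu> *\<^sub>R (G y - G z) - g\<phi> y)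
      = - ((M * t\<^sup>2 - t * \<mu>) *\<^sub>R (G z - G x0)) + t *\<^sub>R (g\<phi> y - \<mu> *\<^sub>R (G y - G x0))
        + (M * t\<^sup>2) *\<^sub>R (G z' - G x0)"
    by (simp add: algebra_simps)
  also have "\<dots> = 0"
    using z'_opt unfolding trial_fields(9) lam .
  finally show ?thesis by simp
qed

text \<open>The descent test holds with \<open>Lnew\<close>, relative smoothness with
  \<open>L\<close>; using the smaller constant leaves the last term as extra gain. The linear term
  is \<open>- Lnew * (D x' y + D y x')\<close> by optimality of \<open>x'\<close>.\<close>

lemma descent:
  "\<phi> x' \<le> \<phi> y - Lnew * D y x' - (Lnew - min Lnew L) * D x' y"
proof -
  obtain i where "x_step_ok d f \<mu> x0 y Lnew"
    using backtrack_cases by blast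
  then have "\<phi> x' \<le> \<phi> y + g\<phi> y \<bullet> (x' - y) + Lnew * D x' y"
    by (simp add: x_step_ok_def Let_def trial_fields(8)[symmetric])
  then have "\<phi> x' \<le> \<phi> y + g\<phi> y \<bullet> (x' - y) + min Lnew L * D x' y"
    using phi_upper[OF x'_U y_U] by (simp add: min_def)
  moreover have "g\<phi> y \<bullet> (x' - y) = - Lnew * (D x' y + D y x')"
  proof -
    have eq: "(G y - G x') \<bullet> (x' - y) = - (D x' y + D y x')"
      using three_point[OF x'_U y_U x'_U] D_self[OF x'_U] by simp
    show ?thesis unfolding x'_grad inner_scaleR_left eq by (simp add: algebra_simps)
  qed
  ultimately show ?thesis by (simp add: algebra_simps)
qed

text \<open>The weight \<tau> is such that the displacements from \<open>y\<close> to the old best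
  point and to \<open>z\<close> average to \<theta> times \<open>z - y\<close>.\<close>

lemma averaged_lower_bound:
  "\<phi> y + \<theta> * (g\<phi> y \<bullet> (z - y)) + \<mu> * t * D z y \<le> (1 - t) * st_phibest s + t * st_philow r"
proof -
  let ?xb = "st_xbest s"
  have "\<phi> y + g\<phi> y \<bullet> (?xb - y) + \<mu> * D ?xb y \<le> \<phi> ?xb"
    using phi_lower[OF s_facts(1) y_U] .
  moreover have "0 \<le> \<mu> * D ?xb y"
    using \<mu>_nonneg D_nonneg[OF U_edom[OF s_facts(1)] y_U] by simp
  ultimately have "(1 - t) * (\<phi> y + g\<phi> y \<bullet> (?xb - y)) \<le> (1 - t) * st_phibest s"
    using t_bounds s_facts(3) by (intro mult_left_mono) auto
  moreover have "(1 - t) *\<^sub>R (?xb - y) + t *\<^sub>R (z - y) = \<theta> *\<^sub>R (z - y)"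
  proof -
    have "(1 - t) *\<^sub>R (?xb - y) + t *\<^sub>R (z - y) = (t - \<tau>) *\<^sub>R (z - ?xb)"
      by (subst trial_fields(5))+ (simp add: algebra_simps)
    also have "t - \<tau> = \<theta> * (1 - \<tau>)"
      using t_\<tau> by (simp add: algebra_simps)
    also have "(\<theta> * (1 - \<tau>)) *\<^sub>R (z - ?xb) = \<theta> *\<^sub>R ((1 - \<tau>) *\<^sub>R (z - ?xb))"
      by simp
    also have "(1 - \<tau>) *\<^sub>R (z - ?xb) = z - y"
      by (subst trial_fields(5)) (simp add: algebra_simps)
    finally show ?thesis .
  qed
  then have "(1 - t) * (g\<phi> y \<bullet> (?xb - y)) + t * (g\<phi> y \<bullet> (z - y)) = \<theta> * (g\<phi> y \<bullet> (z - y))"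
    by (metis inner_add_right inner_scaleR_right)
  ultimately show ?thesis
    by (simp add: trial_fields(6) algebra_simps)
qed

text \<open>\<open>descent\<close> bounds the new best value from above,
  \<open>averaged_lower_bound\<close> the averaged values in the exit condition from below, and
  \<open>\<mu> + e' = M * t\<^sup>2\<close>.\<close>

lemma exit_sufficient:
  assumes "M * t\<^sup>2 * D z z' \<le> Lnew * D y x' + (Lnew - min Lnew L) * D x' y + \<theta> * (g\<phi> y \<bullet> (z - y)) + \<mu> * t * D z y"
  shows "exit_condition d \<mu> s r"
  unfolding exit_condition_def
  using assms descent averaged_lower_bound xbest_facts(3) trial_fields(3) by simp

text \<open>The new minorant averages the old one and the tangent of \<open>f\<close> at
  \<open>y\<close> with weights \<open>1 - t\<close> and \<open>t\<close>.\<close>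

lemma estimate_step:
  assumes "exit_condition d \<mu> s r"
  shows "estimate (abra_state.truncate r)"
proof -
  let ?S = "M * t\<^sup>2"
  \<comment> \<open>For \<open>k = 0\<close> the value of \<open>A\<close> is arbitrary, since
    \<open>t = 1\<close> removes the old minorant.\<close>
  obtain A where A: "k = 0 \<and> A = 0 \<or> st_phibest s \<le> A + st_lambda s \<bullet> z + (\<mu> + e) * D z x0 \<and>
     (\<forall>u\<in>U. A + st_lambda s \<bullet> u \<le> f u)"
    using s_valid by (cases "k = 0") (auto simp: valid_state_def estimate_def)
  define A' where "A' = (1 - t) * A + t * (f y - gradient f y \<bullet> y)"
  have lam: "st_lambda r = (1 - t) *\<^sub>R st_lambda s + t *\<^sub>R gradient f y"
    by (simp add: trial_fields(9) grad_phi_eq[OF y_U])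
  have lam_inner: "A' + st_lambda r \<bullet> u
      = (1 - t) * (A + st_lambda s \<bullet> u) + t * (f y + gradient f y \<bullet> (u - y))" for u
    by (simp add: A'_def lam algebra_simps inner_add_left inner_diff_right)
  have lower: "A' + st_lambda r \<bullet> u \<le> f u" if u: "u \<in> U" for u
  proof -
    have "(1 - t) * (A + st_lambda s \<bullet> u) \<le> (1 - t) * f u"
      using A u t_bounds t_first by (cases "k = 0") (auto intro: mult_left_mono)
    moreover have "t * (f y + gradient f y \<bullet> (u - y)) \<le> t * f u"
      using f_above_tangent[OF u y_U] t_bounds by (intro mult_left_mono) auto
    ultimately show ?thesis
      unfolding lam_inner by (simp add: algebra_simps)
  qed
  \<comment> \<open>Taken relative to \<open>x0\<close> instead of \<open>y\<close>, the lower value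
    is the tangent of \<open>f\<close> plus the regularizer at \<open>z\<close>.\<close>
  have philow: "st_philow r = f y + gradient f y \<bullet> (z - y) + \<mu> * D z x0"
    using phi_gap[OF s_facts(2) y_U] phi_eq[OF s_facts(2)] by (simp add: trial_fields(6))
  have best: "(1 - t) * st_phibest s + t * st_philow r \<le> A' + st_lambda r \<bullet> z + ?S * D z x0"
  proof (cases "k = 0")
    case True
    then have "z = x0" using s_valid by (simp add: valid_state_def)
    then show ?thesis
      unfolding lam_inner philow using t_first[OF True] x0 by simp
  next
    case False
    then have "(1 - t) * st_phibest s \<le> (1 - t) * (A + st_lambda s \<bullet> z + (\<mu> + e) * D z x0)"
      using A t_bounds by (intro mult_left_mono) auto
    moreover have "?S = (1 - t) * (\<mu> + e) + t * \<mu>"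
      using t_step(3) False by (simp add: algebra_simps)
    then have "?S * D z x0 = (1 - t) * ((\<mu> + e) * D z x0) + t * (\<mu> * D z x0)"
      by (simp only: distrib_right mult.assoc)
    ultimately show ?thesis
      unfolding lam_inner philow by (simp add: algebra_simps)
  qed
  \<comment> \<open>The three-point identity and optimality of \<open>z'\<close> turn the
    regularized minorant at \<open>z\<close>, less the \<open>?S * D z z'\<close> of the exit
    condition, into its value at \<open>z'\<close>.\<close>
  have "?S * D z x0 = ?S * D z z' + ?S * D z' x0 + (?S *\<^sub>R (G z' - G x0)) \<bullet> (z - z')"
    unfolding three_point[OF s_facts(2) z'_U x0] by (simp add: algebra_simps)
  also have "?S *\<^sub>R (G z' - G x0) = - st_lambda r"
    using z'_opt by (simp add: add_eq_0_iff2)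
  finally have "st_phibest r \<le> A' + st_lambda r \<bullet> z' + ?S * D z' x0"
    using assms best trial_fields(3) unfolding exit_condition_def
    by (simp add: algebra_simps inner_diff_right)
  then show ?thesis
    unfolding estimate_def using lower trial_fields(3)
    by (auto simp: abra_state.truncate_def)
qed

lemma valid_step:
  assumes "exit_condition d \<mu> s r"
  shows "valid_state (Suc k) (abra_state.truncate r)"
proof -
  have "0 < st_eta r" using e'_pos by simp
  then show ?thesis
    using estimate_step[OF assms] xbest_facts z'_U z'_opt M_bounds Lnew_pos trial_fields(3)
    by (simp add: valid_state_def abra_state.truncate_def)
qed

end

section \<open>Sufficient conditions for exit\<close>

context abra_step
begin

text \<open>Both dual steps are negative multiples of \<open>g\<phi> y\<close>, of sizes
  \<open>1 / Lnew\<close> and \<open>1 / (M * t)\<close>, so comparing divergences gives \<open>M *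
  t\<^sup>2 * D z z' \<le> Lnew * (\<rho>\<^sup>2 * Lnew / M) * D y x'\<close>.\<close>

lemma exit_if_mu_zero:
  assumes \<Omega>: "convex \<Omega>" "distortion_defined (conjugate d) \<Omega>" "distortion (conjugate d) \<Omega> \<le> ereal \<rho>"
    and mem: "G y \<in> \<Omega>" "G x' \<in> \<Omega>" "G z \<in> \<Omega>" "G z' \<in> \<Omega>"
    and "\<mu> = 0" and M_ge: "\<rho>\<^sup>2 * Lnew \<le> M"
  shows "exit_condition d \<mu> s r"
proof (rule exit_sufficient)
  note U = s_facts(2) z'_U y_U x'_U
  have "G x' - G y = (- 1 / Lnew) *\<^sub>R g\<phi> y"
    using x'_grad Lnew_pos by simp
  moreover have "G z' - G z = (- 1 / (M * t)) *\<^sub>R g\<phi> y"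
  proof -
    have "(M * t\<^sup>2) *\<^sub>R (G z' - G z) = (M * t\<^sup>2) *\<^sub>R ((- 1 / (M * t)) *\<^sub>R g\<phi> y)"
      using z'_grad \<open>\<mu> = 0\<close> M_bounds t_bounds by (simp add: power2_eq_square)
    then show ?thesis
      using M_bounds t_bounds by (simp only: scaleR_cancel_left) auto
  qed
  ultimately have "(- 1 / Lnew)\<^sup>2 * D z z' \<le> \<rho>\<^sup>2 * (- 1 / (M * t))\<^sup>2 * D y x'"
    using D_compare[OF \<Omega> U mem(3,4,1,2)] by blast
  then have "(M * t\<^sup>2 * Lnew\<^sup>2) * ((- 1 / Lnew)\<^sup>2 * D z z')
      \<le> (M * t\<^sup>2 * Lnew\<^sup>2) * (\<rho>\<^sup>2 * (- 1 / (M * t))\<^sup>2 * D y x')"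
    using M_bounds t_bounds Lnew_pos by (intro mult_left_mono) auto
  then have "M * t\<^sup>2 * D z z' \<le> Lnew * (\<rho>\<^sup>2 * Lnew / M) * D y x'"
    using M_bounds t_bounds Lnew_pos by (simp add: field_simps power2_eq_square)
  also have "\<dots> \<le> Lnew * 1 * D y x'"
    using M_ge M_bounds Lnew_pos D_nonneg[OF U_edom[OF y_U] x'_U]
    by (intro mult_right_mono mult_left_mono) auto
  also have "\<dots> \<le> Lnew * D y x' + (Lnew - min Lnew L) * D x' y"
    using D_nonneg[OF U_edom[OF x'_U] y_U] by simp
  finally have "M * t\<^sup>2 * D z z' \<le> Lnew * D y x' + (Lnew - min Lnew L) * D x' y" .
  moreover have "\<theta> = 0"
    unfolding \<theta>_def using \<open>\<mu> = 0\<close> by simp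
  ultimately show "M * t\<^sup>2 * D z z' \<le> Lnew * D y x' + (Lnew - min Lnew L) * D x' y
      + \<theta> * (g\<phi> y \<bullet> (z - y)) + \<mu> * t * D z y"
    using \<open>\<mu> = 0\<close> by simp
qed

text \<open>With \<open>q = \<nabla>d\<^sup>*(\<nabla>d(y) - \<nabla>\<phi>(y) / \<mu>)\<close> both dual steps go a fraction of the way towards
  \<open>\<nabla>d(q)\<close>, so both divergences of the exit condition can be compared with those to \<open>q\<close>.
  The slack \<open>Lnew - min Lnew L\<close> of the descent inequality accounts for a doubling that
  overshoots \<open>L\<close>.\<close>

lemma exit_if_mu_pos:
  assumes \<Omega>: "convex \<Omega>" "distortion_defined (conjugate d) \<Omega>" "distortion (conjugate d) \<Omega> \<le> ereal \<rho>"
    and mem: "G y \<in> \<Omega>" "G x' \<in> \<Omega>" "G z \<in> \<Omega>" "G z' \<in> \<Omega>"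
    and q_mem: "dual_q d f \<mu> x0 r \<in> \<Omega>"
    and "\<mu> > 0"
    and x_cond: "\<rho>\<^sup>2 * Lnew\<^sup>2 \<le> (2 * Lnew - min Lnew L) * sqrt (M * Lo)"
    and z_cond: "\<rho>\<^sup>2 * sqrt (M * Lo) \<le> M"
  shows "exit_condition d \<mu> s r"
proof (rule exit_sufficient)
  define q where "q = egradient (conjugate d) (dual_q d f \<mu> x0 r)"
  have "dual_q d f \<mu> x0 r \<in> interior (edom (conjugate d))"
    using \<Omega>(2) q_mem by (auto simp: distortion_defined_def)
  then have q: "q \<in> U" and Gq: "G q = dual_q d f \<mu> x0 r"
    by (simp_all add: q_def grad_dual)
  note U = y_U q x'_U s_facts(2) z'_U
  define R where "R = sqrt (M * Lo)"
  define S where "S = 2 * Lnew - min Lnew L"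
  have R: "0 < R" using M_bounds Lo by (simp add: R_def)
  have \<rho>: "1 \<le> \<rho>" using distortion_ge_1[OF \<Omega>(2,3) mem(1)] .
  have g: "g\<phi> y = \<mu> *\<^sub>R (G y - G q)"
    using \<open>\<mu> > 0\<close> by (simp add: Gq dual_q_def)
  have Gz: "G z' - G z = (\<mu> / (M * t)) *\<^sub>R (G q - G z)"
  proof -
    have "(M * t\<^sup>2) *\<^sub>R (G z' - G z) = (t * \<mu>) *\<^sub>R (G q - G z)"
      unfolding z'_grad g by (simp add: algebra_simps)
    also have "\<dots> = (M * t\<^sup>2) *\<^sub>R ((\<mu> / (M * t)) *\<^sub>R (G q - G z))"
      using M_bounds t_bounds by (simp add: power2_eq_square)
    finally show ?thesis
      using M_bounds t_bounds by (simp only: scaleR_cancel_left) auto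
  qed
  have "Lnew *\<^sub>R (G x' - G y) = \<mu> *\<^sub>R (G q - G y)"
    using x'_grad unfolding g by (metis minus_diff_eq scaleR_minus_right)
  then have "Lnew *\<^sub>R (G x' - G y) = Lnew *\<^sub>R ((\<mu> / Lnew) *\<^sub>R (G q - G y))"
    using Lnew_pos by simp
  then have Gx: "G x' - G y = (\<mu> / Lnew) *\<^sub>R (G q - G y)"
    using Lnew_pos by (simp only: scaleR_cancel_left) auto
  then have Gx': "G y - G x' = (- \<mu> / Lnew) *\<^sub>R (G q - G y)"
    by (metis minus_diff_eq minus_divide_left scaleR_minus_left)
  have nonneg: "0 \<le> D z q" "0 \<le> D y q" "0 \<le> D z y"
    using U by (auto intro: D_nonneg U_edom)
  have gq: "G q \<in> \<Omega>" using q_mem Gq by simp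
  have "M * t\<^sup>2 * D z z' \<le> \<theta> * \<mu> * D z q"
  proof -
    have "1\<^sup>2 * D z z' \<le> \<rho>\<^sup>2 * (\<mu> / (M * t))\<^sup>2 * D z q"
      using D_compare[OF \<Omega> U(4,5,4,2) mem(3,4,3) gq Gz, of 1] by simp
    then have "M * t\<^sup>2 * D z z' \<le> M * t\<^sup>2 * (\<rho>\<^sup>2 * (\<mu> / (M * t))\<^sup>2 * D z q)"
      using M_bounds by (intro mult_left_mono) auto
    also have "\<dots> = (\<rho>\<^sup>2 / M) * \<mu>\<^sup>2 * D z q"
      using M_bounds t_bounds by (simp add: field_simps power2_eq_square)
    also have "\<dots> \<le> (1 / R) * \<mu>\<^sup>2 * D z q"
      using z_cond nonneg R M_bounds by (intro mult_right_mono) (auto simp: field_simps R_def)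
    finally show ?thesis
      by (simp add: \<theta>_def R_def power2_eq_square)
  qed
  moreover have "\<theta> * \<mu> * D y q \<le> Lnew * D y x' + (Lnew - min Lnew L) * D x' y"
  proof -
    have "(\<mu> / Lnew)\<^sup>2 * D y q \<le> \<rho>\<^sup>2 * 1\<^sup>2 * D y x'"
      using D_compare[OF \<Omega> U(1,2,1,3) mem(1) gq mem(1,2) _ Gx, of 1] by simp
    moreover have "(- \<mu> / Lnew)\<^sup>2 * D y q \<le> \<rho>\<^sup>2 * 1\<^sup>2 * D x' y"
      using D_compare[OF \<Omega> U(1,2,3,1) mem(1) gq mem(2,1) _ Gx', of 1] by simp
    \<comment> \<open>The weights \<open>Lnew\<close> and \<open>Lnew - min Lnew L\<close> add up to
      \<open>S\<close>, so both divergences of the gradient step together pay for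
      \<open>D y q\<close>.\<close>
    ultimately have "Lnew * ((\<mu> / Lnew)\<^sup>2 * D y q) + (Lnew - min Lnew L) * ((\<mu> / Lnew)\<^sup>2 * D y q)
        \<le> Lnew * (\<rho>\<^sup>2 * D y x') + (Lnew - min Lnew L) * (\<rho>\<^sup>2 * D x' y)"
      using Lnew_pos by (intro add_mono mult_left_mono) auto
    then have *: "S * (\<mu> / Lnew)\<^sup>2 * D y q
        \<le> \<rho>\<^sup>2 * (Lnew * D y x' + (Lnew - min Lnew L) * D x' y)"
      unfolding S_def by (simp add: algebra_simps)
    have "\<rho>\<^sup>2 * (\<mu>\<^sup>2 / R) \<le> S * (\<mu> / Lnew)\<^sup>2"
    proof -
      have "\<rho>\<^sup>2 * Lnew\<^sup>2 * \<mu>\<^sup>2 \<le> S * R * \<mu>\<^sup>2"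
        using x_cond unfolding S_def R_def by (intro mult_right_mono) auto
      then show ?thesis using R Lnew_pos by (simp add: field_simps)
    qed
    then have "\<rho>\<^sup>2 * (\<mu>\<^sup>2 / R) * D y q \<le> S * (\<mu> / Lnew)\<^sup>2 * D y q"
      using nonneg by (intro mult_right_mono) auto
    then have "\<rho>\<^sup>2 * (\<theta> * \<mu> * D y q) \<le> \<rho>\<^sup>2 * (Lnew * D y x' + (Lnew - min Lnew L) * D x' y)"
      using * by (simp add: \<theta>_def R_def power2_eq_square)
    then show ?thesis using \<rho> by simp
  qed
  \<comment> \<open>The linear term is split at \<open>q\<close>: \<open>D z q\<close> pays for the
    step to \<open>z'\<close>, \<open>D y q\<close> is paid by the descent, and \<open>D z y\<close>
    is covered because \<open>\<theta> \<le> t\<close>.\<close>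
  moreover have eq: "g\<phi> y \<bullet> (z - y) = \<mu> * (D z q - D z y - D y q)"
    unfolding g using three_point[OF U(4,1,2)] by simp
  have "\<theta> * (g\<phi> y \<bullet> (z - y)) = \<theta> * \<mu> * D z q - \<theta> * \<mu> * D y q - \<mu> * \<theta> * D z y"
    unfolding eq by (simp add: algebra_simps)
  moreover have "\<mu> * \<theta> * D z y \<le> \<mu> * t * D z y"
    using \<theta>_bounds \<open>\<mu> > 0\<close> nonneg by (intro mult_right_mono) auto
  ultimately show "M * t\<^sup>2 * D z z' \<le> Lnew * D y x' + (Lnew - min Lnew L) * D x' y
      + \<theta> * (g\<phi> y \<bullet> (z - y)) + \<mu> * t * D z y"
    by linarith
qed

text \<open>The previous conditions without square roots. The second alternative of
  \<open>M_Lnew\<close> is a single doubling: if it overshoots \<open>L\<close>, the slack in the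
  descent compensates.\<close>

lemma exit_if_mu_pos_large:
  assumes \<Omega>: "convex \<Omega>" "distortion_defined (conjugate d) \<Omega>" "distortion (conjugate d) \<Omega> \<le> ereal \<rho>"
    and mem: "G y \<in> \<Omega>" "G x' \<in> \<Omega>" "G z \<in> \<Omega>" "G z' \<in> \<Omega>"
    and q_mem: "dual_q d f \<mu> x0 r \<in> \<Omega>"
    and "\<mu> > 0"
    and M_Lo: "\<rho> ^ 4 * Lo \<le> M"
    and M_Lnew: "\<rho> ^ 4 * Lnew\<^sup>2 \<le> M * Lo \<or> Lnew = 2 * Lo \<and> Lnew \<le> 2 * L \<and> 2 * \<rho> ^ 4 * L \<le> M"
  shows "exit_condition d \<mu> s r"
proof (rule exit_if_mu_pos[OF \<Omega> mem q_mem \<open>\<mu> > 0\<close>])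
  have "(\<rho>\<^sup>2 * sqrt (M * Lo))\<^sup>2 = \<rho> ^ 4 * Lo * M"
    using M_bounds Lo by (simp add: power_mult_distrib)
  also have "\<dots> \<le> M\<^sup>2"
    unfolding power2_eq_square using M_Lo M_bounds by (intro mult_right_mono) auto
  finally show "\<rho>\<^sup>2 * sqrt (M * Lo) \<le> M"
    by (rule power2_le_imp_le) (use M_bounds in simp)
  have *: "\<rho>\<^sup>2 * Lnew\<^sup>2 \<le> (2 * Lnew - min Lnew L) * sqrt (M * Lo)" if "\<rho> ^ 4 * Lnew\<^sup>2 \<le> M * Lo"
  proof -
    have "\<rho>\<^sup>2 * Lnew \<le> sqrt (M * Lo)"
      using that by (intro real_le_rsqrt) (simp add: power_mult_distrib)
    then have "Lnew * (\<rho>\<^sup>2 * Lnew) \<le> (2 * Lnew - min Lnew L) * sqrt (M * Lo)"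
      using Lnew_pos by (intro mult_mono) auto
    then show ?thesis by (simp add: power2_eq_square mult_ac)
  qed
  show "\<rho>\<^sup>2 * Lnew\<^sup>2 \<le> (2 * Lnew - min Lnew L) * sqrt (M * Lo)"
  proof (cases "\<rho> ^ 4 * Lnew\<^sup>2 \<le> M * Lo")
    case False
    then have a: "Lnew = 2 * Lo" "Lnew \<le> 2 * L" "2 * \<rho> ^ 4 * L \<le> M" using M_Lnew by auto
    have L_pos: "0 < L" using \<mu>_nonneg \<mu>_less by simp
    have "2 * \<rho> ^ 4 * L * Lo \<le> M * Lo" using a(3) Lo by (intro mult_right_mono) auto
    then have MLo: "\<rho> ^ 4 * (L * Lnew) \<le> M * Lo" unfolding a(1) by (simp add: mult_ac)
    have "L < Lnew"
    proof (rule ccontr)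
      assume "\<not> L < Lnew"
      then have "\<rho> ^ 4 * (Lnew * Lnew) \<le> \<rho> ^ 4 * (L * Lnew)"
        using Lnew_pos by (intro mult_left_mono mult_right_mono) auto
      then show False using False MLo by (simp add: power2_eq_square)
    qed
    \<comment> \<open>The factorization yields
      \<open>Lnew ^ 3 \<le> (2 * Lnew - L)\<^sup>2 * L\<close> for \<open>Lnew\<close> between
      \<open>L\<close> and \<open>2 * L\<close>; with \<open>MLo\<close> this is the squared
      goal.\<close>
    have "(2 * Lnew - L)\<^sup>2 * L - Lnew ^ 3 = (Lnew - L) * ((Lnew - L) * (2 * L - Lnew) + L\<^sup>2)"
      by algebra
    also have "\<dots> \<ge> 0" using \<open>L < Lnew\<close> a(2) by auto
    finally have "Lnew ^ 3 * Lnew \<le> (2 * Lnew - L)\<^sup>2 * L * Lnew"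
      using Lnew_pos by (intro mult_right_mono) auto
    then have "\<rho> ^ 4 * (Lnew ^ 3 * Lnew) \<le> \<rho> ^ 4 * ((2 * Lnew - L)\<^sup>2 * L * Lnew)"
      by (intro mult_left_mono) auto
    also have "\<dots> = (2 * Lnew - L)\<^sup>2 * (\<rho> ^ 4 * (L * Lnew))" by (simp add: mult_ac)
    also have "\<dots> \<le> (2 * Lnew - L)\<^sup>2 * (M * Lo)" using MLo by (intro mult_left_mono) auto
    finally have "(\<rho>\<^sup>2 * Lnew\<^sup>2)\<^sup>2 \<le> (2 * Lnew - L)\<^sup>2 * (M * Lo)"
      by (simp add: eval_nat_numeral mult_ac)
    then have "\<rho>\<^sup>2 * Lnew\<^sup>2 \<le> sqrt ((2 * Lnew - L)\<^sup>2 * (M * Lo))" by (rule real_le_rsqrt)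
    also have "\<dots> = (2 * Lnew - L) * sqrt (M * Lo)"
      using \<open>L < Lnew\<close> L_pos by (simp add: real_sqrt_mult)
    finally show ?thesis using \<open>L < Lnew\<close> by simp
  qed (rule *)
qed

text \<open>The next trial uses \<open>2 * M\<close>, so this bounds the ratio of \<open>M\<close>
  to the \<open>L\<close> estimate there. Without doubling of \<open>Lo\<close>, failure forces
  \<open>M < \<rho> ^ 4 * Lo\<close>; one doubling keeps the ratio and failure forces
  \<open>M < 2 * \<rho> ^ 4 * L\<close>; two or more halve the bound \<open>V\<close>.\<close>

lemma failed_mu_pos:
  assumes \<Omega>: "convex \<Omega>" "distortion_defined (conjugate d) \<Omega>" "distortion (conjugate d) \<Omega> \<le> ereal \<rho>"
    and mem: "G y \<in> \<Omega>" "G x' \<in> \<Omega>" "G z \<in> \<Omega>" "G z' \<in> \<Omega>"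
    and q_mem: "dual_q d f \<mu> x0 r \<in> \<Omega>"
    and "\<mu> > 0" and fail: "\<not> exit_condition d \<mu> s r"
    and Lo_le: "Lo \<le> 2 * L" and V: "2 * \<rho> ^ 4 \<le> V" "M \<le> V * Lo"
  shows "2 * M \<le> V * Lnew" and "M < 2 * \<rho> ^ 4 * L \<or> 2 * M \<le> V / 2 * Lnew"
proof -
  obtain i where i: "Lnew = Lo * 2 ^ i" "0 < i \<Longrightarrow> Lnew < 2 * L" using backtrack_cases by blast
  note large = exit_if_mu_pos_large[OF \<Omega> mem q_mem \<open>\<mu> > 0\<close>]
  have \<rho>: "0 \<le> \<rho> ^ 4" by simp
  have V_nonneg: "0 \<le> V" using V(1) \<rho> by linarith
  have \<rho>L: "\<rho> ^ 4 * Lo \<le> 2 * \<rho> ^ 4 * L" using mult_left_mono[OF Lo_le \<rho>] by simp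
  consider "i = 0" | "i = 1" | "2 \<le> i" by linarith
  then have "2 * M \<le> V * Lnew \<and> (M < 2 * \<rho> ^ 4 * L \<or> 2 * M \<le> V / 2 * Lnew)"
  proof cases
    case 1
    then have Lnew: "Lnew = Lo" using i by simp
    have "\<not> \<rho> ^ 4 * Lo \<le> M"
    proof
      assume a: "\<rho> ^ 4 * Lo \<le> M"
      then have "\<rho> ^ 4 * Lo * Lo \<le> M * Lo" using Lo by (intro mult_right_mono) auto
      then show False using large a fail Lnew by (simp add: power2_eq_square mult.assoc)
    qed
    moreover have "2 * \<rho> ^ 4 * Lo \<le> V * Lo" using V Lo by (intro mult_right_mono) auto
    ultimately show ?thesis using \<rho>L unfolding Lnew by linarith
  next
    case 2
    then have "Lnew = 2 * Lo" "Lnew \<le> 2 * L" using i by simp_all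
    then show ?thesis using large fail \<rho>L V(2) by fastforce
  next
    case 3
    then have "(2::real)\<^sup>2 \<le> 2 ^ i" by (intro power_increasing) auto
    then have "4 * Lo \<le> Lnew" using Lo unfolding i by simp
    then have "V * (4 * Lo) \<le> V * Lnew" using V_nonneg by (rule mult_left_mono)
    then show ?thesis using V(2) M_bounds by simp
  qed
  then show "2 * M \<le> V * Lnew" "M < 2 * \<rho> ^ 4 * L \<or> 2 * M \<le> V / 2 * Lnew" by blast+
qed

end

section \<open>Recursions for real sequences\<close>

text \<open>Iterating, \<open>m (N + n)\<close> is at most the maximum of \<open>m N / 2 ^ n\<close>
  and \<open>C\<close>, because \<open>C / 2 \<le> C\<close>.\<close>

lemma eventually_halved:
  fixes m :: "nat \<Rightarrow> real"
  assumes "0 < C" and step: "\<And>k. N \<le> k \<Longrightarrow> m (Suc k) \<le> max (m k / 2) C"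
  shows "\<exists>N'\<ge>N. \<forall>k\<ge>N'. m k \<le> C"
proof -
  have bound: "m (N + n) \<le> max (m N / 2 ^ n) C" for n
  proof (induction n)
    case (Suc n)
    have "m (N + n) / 2 \<le> max (m N / 2 ^ Suc n) C"
      using Suc assms(1) by (auto simp: max_def split: if_splits)
    then show ?case using step[of "N + n"] by simp
  qed simp
  obtain n where n: "m N / C < 2 ^ n" using real_arch_pow[of 2 "m N / C"] by auto
  have "m k \<le> C" if "N + n \<le> k" for k
  proof -
    have "(2::real) ^ n \<le> 2 ^ (k - N)" using that by (intro power_increasing) auto
    then have "m N / C \<le> 2 ^ (k - N)" using n by linarith
    then have "m N / 2 ^ (k - N) \<le> C" using assms(1) by (simp add: field_simps)
    then show ?thesis using bound[of "k - N"] that by simp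
  qed
  then show ?thesis by (intro exI[of _ "N + n"]) auto
qed

text \<open>The second alternative of the hypothesis improves the bound \<open>V\<close> on the ratio \<open>m / l\<close>,
  which can happen only finitely often before the ratio drops below \<open>c\<close>.\<close>

lemma eventually_bounded_by_ratio:
  fixes m l :: "nat \<Rightarrow> real"
  assumes "0 < c" "0 < B" and l: "\<And>k. K \<le> k \<Longrightarrow> 0 < l k \<and> l k \<le> B"
    and ratio: "\<And>k V. K \<le> k \<Longrightarrow> c \<le> V \<Longrightarrow> m k \<le> V * l k \<Longrightarrow> m (Suc k) \<le> V * l (Suc k)"
    and step: "\<And>k V. K \<le> k \<Longrightarrow> c \<le> V \<Longrightarrow> m k \<le> V * l k \<Longrightarrow>
      m (Suc k) \<le> max (m k / 2) (c * B) \<or> m (Suc k) \<le> max (V / 2) c * l (Suc k)"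
  shows "\<exists>N\<ge>K. \<forall>k\<ge>N. m k \<le> c * B"
proof -
  have persist: "m (k + n) \<le> V * l (k + n)" if "K \<le> k" "c \<le> V" "m k \<le> V * l k" for k n V
    using that by (induction n) (auto intro: ratio)
  show ?thesis
  proof (cases "\<exists>N\<ge>K. \<forall>k\<ge>N. m (Suc k) \<le> max (m k / 2) (c * B)")
    case True
    then obtain N where "N \<ge> K" "\<forall>k\<ge>N. m (Suc k) \<le> max (m k / 2) (c * B)" by blast
    then show ?thesis using eventually_halved[of "c * B" N m] assms(1,2) by (auto intro: order_trans)
  next
    case False
    \<comment> \<open>Here the halving of \<open>m\<close> fails infinitely often, so the second
      alternative of \<open>step\<close> can be used any number of times, starting from the ratio at
      \<open>K\<close>.\<close>
    define V where "V = max c (m K / l K)"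
    have "\<exists>k\<ge>K. m k \<le> max (V / 2 ^ n) c * l k" for n
    proof (induction n)
      case 0
      have "m K \<le> max V c * l K"
        using l[of K] by (simp add: V_def max_def field_simps)
      then show ?case by auto
    next
      case (Suc n)
      then obtain k where k: "k \<ge> K" "m k \<le> max (V / 2 ^ n) c * l k" by blast
      obtain k' where k': "k' \<ge> k" "\<not> m (Suc k') \<le> max (m k' / 2) (c * B)"
        using False k(1) by blast
      have "m k' \<le> max (V / 2 ^ n) c * l k'"
        using persist[OF k(1) _ k(2), of "k' - k"] k'(1) by simp
      then have "m (Suc k') \<le> max (max (V / 2 ^ n) c / 2) c * l (Suc k')"
        using step[of k' "max (V / 2 ^ n) c"] k(1) k' by simp
      also have "max (max (V / 2 ^ n) c / 2) c = max (V / 2 ^ Suc n) c"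
      proof -
        have "c * 2 ^ n \<le> c * (2 * 2 ^ n)" using assms(1) by simp
        then have "V \<le> c * (2 * 2 ^ n)" if "V \<le> c * 2 ^ n" using that by linarith
        then show ?thesis using assms(1) by (simp add: max_def field_simps)
      qed
      finally show ?case using k(1) k'(1) by (intro exI[of _ "Suc k'"]) auto
    qed
    \<comment> \<open>Once \<open>V / 2 ^ n\<close> is below \<open>c\<close>, the ratio bound is
      \<open>c\<close> and persists; \<open>l \<le> B\<close> then gives the claim.\<close>
    moreover obtain n where "V / c < 2 ^ n" using real_arch_pow[of 2 "V / c"] by auto
    then have "max (V / 2 ^ n) c = c" using assms(1) by (simp add: field_simps max_def)
    ultimately obtain k where k: "k \<ge> K" "m k \<le> c * l k" by metis
    have "m k' \<le> c * B" if "k' \<ge> k" for k'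
    proof -
      have "m k' \<le> c * l k'" using persist[OF k(1) order_refl k(2), of "k' - k"] that by simp
      also have "\<dots> \<le> c * B" using l[of k'] k(1) that assms(1) by (intro mult_left_mono) auto
      finally show ?thesis .
    qed
    then show ?thesis using k(1) by blast
  qed
qed

text \<open>\<open>1 / sqrt (e k)\<close> grows by at least \<open>1 / (2 * sqrt B)\<close> in each
  step.\<close>

lemma quadratic_rate:
  fixes e m :: "nat \<Rightarrow> real"
  assumes "0 < B" and e: "\<And>k. N \<le> k \<Longrightarrow> 0 < e k"
    and step: "\<And>k. N \<le> k \<Longrightarrow> \<exists>t>0. e (Suc k) = (1 - t) * e k \<and> m k * t\<^sup>2 = e (Suc k)"
    and m: "\<And>k. N \<le> k \<Longrightarrow> 0 < m k \<and> m k \<le> B"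
    and "N \<le> k"
  shows "e k \<le> e N / (1 + (real k - real N) * sqrt (e N) / (2 * sqrt B))\<^sup>2"
proof -
  have inv: "1 / sqrt (e N) + real n / (2 * sqrt B) \<le> 1 / sqrt (e (N + n))" for n
  proof (induction n)
    case (Suc n)
    define a b where "a = sqrt (e (N + n))" and "b = sqrt (e (N + Suc n))"
    obtain t where t: "t > 0" "e (Suc (N + n)) = (1 - t) * e (N + n)" "m (N + n) * t\<^sup>2 = e (Suc (N + n))"
      using step[of "N + n"] by auto
    have ab: "0 < a" "0 < b" "a\<^sup>2 = e (N + n)" "b\<^sup>2 = e (Suc (N + n))"
      using e[of "N + n"] e[of "Suc (N + n)"] by (auto simp: a_def b_def)
    have sq: "b\<^sup>2 \<le> (sqrt B * t)\<^sup>2"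
      unfolding ab(4) t(3)[symmetric]
      using m[of "N + n"] assms(1) by (simp add: power_mult_distrib mult_right_mono)
    have b_le: "b \<le> sqrt B * t"
      by (rule power2_le_imp_le[OF sq]) (use assms(1) t(1) in simp)
    have sq': "b\<^sup>2 \<le> a\<^sup>2"
      using t(1) e[of "N + n"] unfolding ab(3,4) t(2) by (simp add: mult_le_cancel_right1)
    have "b \<le> a" by (rule power2_le_imp_le[OF sq']) (use ab in simp)
    have "(a - b) * (a + b) = a\<^sup>2 - b\<^sup>2"
      by (simp add: algebra_simps power2_eq_square)
    also have "\<dots> = t * a\<^sup>2"
      using t(2) unfolding ab(3,4)[symmetric] by (simp add: algebra_simps)
    also have "t * a\<^sup>2 = (t * a) * a" by (simp add: power2_eq_square)
    finally have *: "(a - b) * (a + b) = (t * a) * a" .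
    \<comment> \<open>As \<open>a + b \<le> 2 * a\<close>, this yields
      \<open>t * a \<le> 2 * (a - b)\<close>; with \<open>b \<le> sqrt B * t\<close> the growth
      claim follows after dividing by \<open>a * b\<close>.\<close>
    have "(a - b) * (a + b) \<le> (a - b) * (2 * a)"
      using \<open>b \<le> a\<close> by (intro mult_left_mono) auto
    then have "(t * a) * a \<le> (2 * (a - b)) * a" unfolding * by (simp add: mult_ac)
    then have ta: "t * a \<le> 2 * (a - b)" using ab(1) by simp
    have "b * a \<le> sqrt B * t * a" using b_le ab(1) by (intro mult_right_mono) auto
    also have "\<dots> \<le> sqrt B * (2 * (a - b))"
      unfolding mult.assoc using ta assms(1) by (intro mult_left_mono) auto
    finally have "b * a \<le> sqrt B * (2 * (a - b))" .
    then have "1 / a + 1 / (2 * sqrt B) \<le> 1 / b"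
      using ab assms(1) by (simp add: field_simps)
    with Suc show ?case
      by (simp add: a_def b_def add_divide_distrib)
  qed simp
  define r where "r = 1 + (real k - real N) * sqrt (e N) / (2 * sqrt B)"
  have "0 < e N" using e by simp
  then have "0 \<le> (real k - real N) * sqrt (e N) / (2 * sqrt B)"
    using assms(1,5) by (intro divide_nonneg_pos mult_nonneg_nonneg) auto
  then have r: "1 \<le> r" by (simp add: r_def)
  have pos: "0 < sqrt (e N)" "0 < sqrt (e k)" using e assms(5) by auto
  have "r / sqrt (e N) \<le> 1 / sqrt (e k)"
    using inv[of "k - N"] assms(5) pos by (simp add: r_def add_divide_distrib of_nat_diff)
  then have "sqrt (e k) \<le> sqrt (e N) / r"
    using pos r by (simp add: field_simps)
  then have "(sqrt (e k))\<^sup>2 \<le> (sqrt (e N) / r)\<^sup>2"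
    using pos by (intro power_mono) auto
  then show ?thesis
    using e[of k] e[of N] assms(5) by (simp add: power_divide r_def)
qed

text \<open>From \<open>m k * t\<^sup>2 \<ge> \<mu>\<close> and \<open>m k \<le> B\<close> each
  \<open>t\<close> is at least \<open>sqrt (\<mu> / B)\<close>; \<open>\<mu> \<le> B\<close> keeps
  the contraction factor nonnegative.\<close>

lemma linear_rate:
  fixes e m :: "nat \<Rightarrow> real"
  assumes "0 < \<mu>" "\<mu> \<le> B" and e: "\<And>k. N \<le> k \<Longrightarrow> 0 < e k"
    and step: "\<And>k. N \<le> k \<Longrightarrow> \<exists>t>0. e (Suc k) = (1 - t) * e k \<and> m k * t\<^sup>2 = e (Suc k) + \<mu>"
    and m: "\<And>k. N \<le> k \<Longrightarrow> 0 < m k \<and> m k \<le> B"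
    and "N \<le> k"
  shows "e k \<le> e N * (1 - sqrt (\<mu> / B)) ^ (k - N)"
proof -
  let ?c = "1 - sqrt (\<mu> / B)"
  have c: "0 \<le> ?c" using assms by simp
  have "e (N + n) \<le> e N * ?c ^ n" for n
  proof (induction n)
    case (Suc n)
    obtain t where t: "t > 0" "e (Suc (N + n)) = (1 - t) * e (N + n)"
        "m (N + n) * t\<^sup>2 = e (Suc (N + n)) + \<mu>"
      using step[of "N + n"] by auto
    have "\<mu> \<le> m (N + n) * t\<^sup>2" using t(3) e[of "Suc (N + n)"] by simp
    also have "\<dots> \<le> B * t\<^sup>2" using m[of "N + n"] by (intro mult_right_mono) auto
    finally have "\<mu> / B \<le> t\<^sup>2" using assms(1,2) by (simp add: field_simps)
    then have "sqrt (\<mu> / B) \<le> t" using t(1) by (intro real_le_lsqrt) auto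
    then have "e (Suc (N + n)) \<le> ?c * e (N + n)"
      unfolding t(2) using e[of "N + n"] by (intro mult_right_mono) auto
    also have "\<dots> \<le> ?c * (e N * ?c ^ n)" using Suc c by (rule mult_left_mono)
    finally show ?case by (simp add: mult_ac)
  qed simp
  from this[of "k - N"] show ?thesis using assms(6) by simp
qed

section \<open>The run of the algorithm\<close>

lemma st_Lin_trial: "st_Lin (trial d f \<mu> x0 k s Mo Lo pb xb) = Lo"
  by (simp only: trial_def Let_def abra_trial.select_convs)

locale abra_gd = bregman_problem d f \<mu> L x0
  for d :: "real^'n \<Rightarrow> ereal" and f \<mu> L x0 +
  fixes L0 Minit :: real
  assumes L0_pos: "0 < L0" and Minit_pos: "0 < Minit"
    and solvable: "subproblems_solvable d f \<mu> x0 L0 Minit"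
begin

abbreviation "run \<equiv> abra_run d f \<mu> x0 L0 Minit"
abbreviation "trial_no \<equiv> trials d f \<mu> x0"
abbreviation "exits \<equiv> exit_condition d \<mu>"
abbreviation "local_dist_le \<equiv> local_distortion_le d f \<mu> x0"

text \<open>Starting values of trial \<open>j\<close>: \<open>M\<close> before its doubling,
  \<open>L\<close> before the backtracking, and the best point so far. They merge the two clauses of
  \<open>trials\<close>.\<close>

definition M_in where
  "M_in k s j = (case j of 0 \<Rightarrow> max (st_M s / 4) \<mu> | Suc i \<Rightarrow> st_M (trial_no k s i))"
definition L_in where
  "L_in k s j = (case j of 0 \<Rightarrow> max (st_L s / 2) \<mu> | Suc i \<Rightarrow> st_L (trial_no k s i))"
definition phibest_in where
  "phibest_in k s j = (case j of 0 \<Rightarrow> st_phibest s | Suc i \<Rightarrow> st_phibest (trial_no k s i))"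
definition xbest_in where
  "xbest_in k s j = (case j of 0 \<Rightarrow> st_xbest s | Suc i \<Rightarrow> st_xbest (trial_no k s i))"

lemma trial_no_eq:
  "trial_no k s j = trial d f \<mu> x0 k s (M_in k s j) (L_in k s j) (phibest_in k s j) (xbest_in k s j)"
  by (cases j) (simp_all add: M_in_def L_in_def phibest_in_def xbest_in_def Let_def)

abbreviation "step_at k s j \<equiv> abra_step d f \<mu> L x0 k s
  (M_in k s j) (L_in k s j) (phibest_in k s j) (xbest_in k s j) (trial_no k s j)"

lemma step_atI:
  assumes "run k = Some s" "valid_state k s" "executed d f \<mu> x0 k s j"
    and "\<mu> \<le> M_in k s j" "0 < M_in k s j" "\<mu> \<le> L_in k s j" "0 < L_in k s j"
    and "xbest_in k s j \<in> U" "phibest_in k s j = \<phi> (xbest_in k s j)"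
  shows "step_at k s j"
proof -
  have Lin: "st_Lin (trial_no k s j) = L_in k s j"
    by (subst trial_no_eq) (rule st_Lin_trial)
  have "(\<forall>i. (\<forall>i'<i. \<not> x_step_ok d f \<mu> x0 (st_y (trial_no k s j)) (L_in k s j * 2 ^ i')) \<longrightarrow>
      minimizers_interior d UNIV (x_subproblem d f \<mu> x0 (st_y (trial_no k s j)) (L_in k s j * 2 ^ i))) \<and>
    minimizers_interior d UNIV (z_subproblem d \<mu> x0 (st_lambda (trial_no k s j)) (st_eta (trial_no k s j)))"
    using solvable assms(1,3) unfolding subproblems_solvable_def Let_def Lin[symmetric] by blast
  then show ?thesis
    using assms trial_no_eq bregman_problem_axioms
    by (intro abra_step.intro abra_step_axioms.intro) blast+
qed

lemma executed_Suc: "executed d f \<mu> x0 k s (Suc j) \<Longrightarrow> executed d f \<mu> x0 k s j \<and> \<not> exits s (trial_no k s j)"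
  by (simp add: executed_def less_Suc_eq)

text \<open>Each trial hands over values that satisfy the hypotheses of the next. Only executed
  trials are covered, as solvability is assumed for those.\<close>

lemma step_at:
  assumes "run k = Some s" "valid_state k s" "executed d f \<mu> x0 k s j"
  shows "step_at k s j"
  using assms(3)
proof (induction j)
  case 0
  then show ?case
    using assms(1,2) \<mu>_nonneg
    by (intro step_atI) (auto simp: M_in_def L_in_def phibest_in_def xbest_in_def valid_state_def)
next
  case (Suc j)
  then have step: "step_at k s j" using executed_Suc by blast
  show ?case
    using abra_step.M_bounds[OF step] abra_step.Lnew_pos[OF step] abra_step.Lnew_ge[OF step]
      abra_step.Lo[OF step] abra_step.xbest_facts[OF step] assms(1,2) Suc.prems
    by (intro step_atI) (auto simp: M_in_def L_in_def phibest_in_def xbest_in_def)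
qed

lemma run_Suc:
  assumes "run k = Some s" "run (Suc k) = Some s'"
  obtains J where "exits s (trial_no k s J)" "executed d f \<mu> x0 k s J"
    "s' = abra_state.truncate (trial_no k s J)"
proof -
  have ex: "\<exists>j. exits s (trial_no k s j)"
    using assms by (auto split: if_splits)
  define J where "J = (LEAST j. exits s (trial_no k s j))"
  show thesis
  proof (rule that[of J])
    show "exits s (trial_no k s J)" unfolding J_def using ex by (rule LeastI_ex)
    show "executed d f \<mu> x0 k s J" unfolding executed_def J_def using not_less_Least by blast
    show "s' = abra_state.truncate (trial_no k s J)" using assms ex by (simp add: J_def)
  qed
qed

section \<open>The invariant along the run\<close>

lemma valid_initial: "valid_state 0 (initial_state d f \<mu> x0 L0 Minit)"
  using x0 L0_pos Minit_pos by (simp add: valid_state_def initial_state_def)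

lemma run_valid: "run k = Some s \<Longrightarrow> valid_state k s"
proof (induction k arbitrary: s)
  case 0
  then show ?case using valid_initial by simp
next
  case (Suc k)
  then obtain s0 where s0: "run k = Some s0" by (auto split: option.splits)
  obtain J where J: "exits s0 (trial_no k s0 J)" "executed d f \<mu> x0 k s0 J"
    "s = abra_state.truncate (trial_no k s0 J)"
    using run_Suc[OF s0 Suc.prems] by blast
  show ?case
    using abra_step.valid_step[OF step_at[OF s0 Suc.IH[OF s0] J(2)] J(1)] J(3) by simp
qed

lemma step_of_run: "run k = Some s \<Longrightarrow> executed d f \<mu> x0 k s j \<Longrightarrow> step_at k s j"
  using step_at run_valid by blast

lemma Omega_facts:
  assumes "local_dist_le k s \<rho>" "executed d f \<mu> x0 k s j"
  shows "convex (Omega d f \<mu> x0 k s)" "distortion_defined (conjugate d) (Omega d f \<mu> x0 k s)"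
    "distortion (conjugate d) (Omega d f \<mu> x0 k s) \<le> ereal \<rho>"
    "G (st_y (trial_no k s j)) \<in> Omega d f \<mu> x0 k s" "G (st_xnext (trial_no k s j)) \<in> Omega d f \<mu> x0 k s"
    "G (st_z s) \<in> Omega d f \<mu> x0 k s" "G (st_z (trial_no k s j)) \<in> Omega d f \<mu> x0 k s"
    "\<mu> > 0 \<Longrightarrow> dual_q d f \<mu> x0 (trial_no k s j) \<in> Omega d f \<mu> x0 k s"
proof -
  show "convex (Omega d f \<mu> x0 k s)" by (simp add: Omega_def convex_convex_hull)
  show "distortion_defined (conjugate d) (Omega d f \<mu> x0 k s)"
    "distortion (conjugate d) (Omega d f \<mu> x0 k s) \<le> ereal \<rho>"
    using assms(1) by (simp_all add: local_distortion_le_def)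
  let ?r = "trial_no k s j"
  have sub: "dual_segments d f \<mu> x0 s ?r \<subseteq> Omega d f \<mu> x0 k s"
    unfolding Omega_def using assms(2) by (intro order_trans[OF _ hull_subset]) auto
  have "{G (st_y ?r), G (st_xnext ?r), G (st_z s), G (st_z ?r)} \<subseteq> dual_segments d f \<mu> x0 s ?r"
    by (auto simp: dual_segments_def)
  then show "G (st_y ?r) \<in> Omega d f \<mu> x0 k s" "G (st_xnext ?r) \<in> Omega d f \<mu> x0 k s"
    "G (st_z s) \<in> Omega d f \<mu> x0 k s" "G (st_z ?r) \<in> Omega d f \<mu> x0 k s"
    using sub by blast+
  show "dual_q d f \<mu> x0 ?r \<in> Omega d f \<mu> x0 k s" if "\<mu> > 0"
  proof -
    \<comment> \<open>The segments end in \<open>G\<close> of the conjugate gradient of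
      \<open>dual_q\<close>; this is \<open>dual_q\<close> itself since \<open>G\<close> inverts
      that gradient there.\<close>
    have "dual_q d f \<mu> x0 ?r \<in> interior (edom (conjugate d))"
      using assms that by (simp add: local_distortion_le_def)
    then have "G (egradient (conjugate d) (dual_q d f \<mu> x0 ?r)) = dual_q d f \<mu> x0 ?r"
      by (rule grad_dual)
    then have "dual_q d f \<mu> x0 ?r \<in> dual_segments d f \<mu> x0 s ?r"
      using that by (simp add: dual_segments_def Let_def)
    then show ?thesis using sub by blast
  qed
qed

lemma rho_ge_1:
  assumes "local_dist_le k s \<rho>"
  shows "1 \<le> \<rho>"
proof -
  have "executed d f \<mu> x0 k s 0" by (simp add: executed_def)
  from Omega_facts(2-4)[OF assms this] show ?thesis by (rule distortion_ge_1)
qed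

text \<open>Backtracking never lowers the estimate, and doubles only values below
  \<open>L\<close>.\<close>

lemma L_in_bounds:
  assumes "run k = Some s" "executed d f \<mu> x0 k s j"
  shows "L_in k s 0 \<le> L_in k s j" "L_in k s j \<le> max (L_in k s 0) (2 * L)"
proof -
  have "L_in k s 0 \<le> L_in k s j \<and> L_in k s j \<le> max (L_in k s 0) (2 * L)"
    using assms(2)
  proof (induction j)
    case (Suc j)
    then have step: "step_at k s j" and IH: "L_in k s 0 \<le> L_in k s j" "L_in k s j \<le> max (L_in k s 0) (2 * L)"
      using executed_Suc step_of_run[OF assms(1)] by blast+
    have "L_in k s (Suc j) = st_L (trial_no k s j)" by (simp add: L_in_def)
    then show ?case
      using abra_step.Lnew_ge[OF step] abra_step.Lnew_le[OF step] IH by auto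
  qed simp
  then show "L_in k s 0 \<le> L_in k s j" "L_in k s j \<le> max (L_in k s 0) (2 * L)" by blast+
qed

lemma st_M_trial: "step_at k s j \<Longrightarrow> st_M (trial_no k s j) = 2 * M_in k s j"
  by (rule abra_step.trial_fields(1))

text \<open>Otherwise \<open>M\<close> would double at each trial while the \<open>L\<close>
  estimates stay between \<open>l\<close> and \<open>B\<close>, and so pass every threshold of the
  exit criteria.\<close>

lemma inner_loop_terminates:
  assumes run: "run k = Some s" and dist: "local_dist_le k s \<rho>"
  shows "\<exists>j. exits s (trial_no k s j)"
proof (rule ccontr)
  assume none: "\<nexists>j. exits s (trial_no k s j)"
  then have exec: "executed d f \<mu> x0 k s j" for j by (simp add: executed_def)
  note step = step_of_run[OF run exec]
  define m l B where "m = 2 * M_in k s 0" and "l = L_in k s 0" and "B = max l (2 * L)"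
  have pos: "0 < m" "0 < l" "0 < B"
    using abra_step.Mo(2)[OF step[of 0]] abra_step.Lo(2)[OF step[of 0]] by (auto simp: m_def l_def B_def)
  have M: "st_M (trial_no k s j) = 2 ^ j * m" for j
  proof (induction j)
    case 0
    show ?case using st_M_trial[OF step[of 0]] by (simp add: m_def)
  next
    case (Suc j)
    then show ?case using st_M_trial[OF step[of "Suc j"]] by (simp add: M_in_def)
  qed
  \<comment> \<open>The summands are the thresholds: the first for \<open>\<mu> = 0\<close>, the
    other two for \<open>\<mu> > 0\<close>. Dividing by \<open>l\<close> works because
    \<open>l \<le> L_in k s j\<close>.\<close>
  obtain j where j: "(\<rho>\<^sup>2 * B + \<rho> ^ 4 * B + \<rho> ^ 4 * B\<^sup>2 / l) / m < 2 ^ j"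
    using real_arch_pow[of 2] by auto
  let ?r = "trial_no k s j"
  interpret abra_step d f \<mu> L x0 k s "M_in k s j" "L_in k s j" "phibest_in k s j" "xbest_in k s j" ?r
    by (rule step)
  have terms: "0 \<le> \<rho>\<^sup>2 * B" "0 \<le> \<rho> ^ 4 * B" "0 \<le> \<rho> ^ 4 * B\<^sup>2 / l"
    using pos by auto
  have "\<rho>\<^sup>2 * B + \<rho> ^ 4 * B + \<rho> ^ 4 * B\<^sup>2 / l < st_M ?r"
    using j pos M by (simp add: field_simps)
  then have big: "\<rho>\<^sup>2 * B \<le> st_M ?r" "\<rho> ^ 4 * B \<le> st_M ?r" "\<rho> ^ 4 * B\<^sup>2 / l \<le> st_M ?r"
    using terms by linarith+
  have Lin: "l \<le> L_in k s j" "L_in k s j \<le> B"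
    using L_in_bounds[OF run exec, of j] by (simp_all add: l_def B_def)
  then have LB: "st_L ?r \<le> B"
    using Lnew_le by (auto simp: B_def)
  note \<Omega> = Omega_facts[OF dist exec[of j]]
  have "exits s ?r"
  proof (cases "\<mu> = 0")
    case True
    have "\<rho>\<^sup>2 * st_L ?r \<le> \<rho>\<^sup>2 * B" using LB by (intro mult_left_mono) auto
    then show ?thesis using exit_if_mu_zero[OF \<Omega>(1-7) True] big(1) by simp
  next
    case False
    then have "\<mu> > 0" using \<mu>_nonneg by simp
    have "\<rho> ^ 4 * L_in k s j \<le> \<rho> ^ 4 * B" using Lin by (intro mult_left_mono) auto
    moreover have "\<rho> ^ 4 * (st_L ?r)\<^sup>2 \<le> st_M ?r * L_in k s j"
    proof -
      have "\<rho> ^ 4 * (st_L ?r)\<^sup>2 \<le> \<rho> ^ 4 * B\<^sup>2"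
        using LB Lnew_pos by (intro mult_left_mono power_mono) auto
      also have "\<dots> \<le> st_M ?r * l" using big(3) pos by (simp add: field_simps)
      also have "\<dots> \<le> st_M ?r * L_in k s j" using Lin M_bounds by (intro mult_left_mono) auto
      finally show ?thesis .
    qed
    ultimately show ?thesis
      using exit_if_mu_pos_large[OF \<Omega>(1-7) \<Omega>(8)[OF \<open>\<mu> > 0\<close>] \<open>\<mu> > 0\<close>] big(2) by simp
  qed
  then show False using none by blast
qed

section \<open>Change of the \<open>L\<close> estimate, \<open>eta\<close> and \<open>M\<close> over
  one iteration\<close>

lemma iteration_L:
  assumes "run k = Some s" "run (Suc k) = Some s'"
  shows "st_L s' \<le> max (st_L s / 2) (2 * L)"
proof -
  obtain J where J: "executed d f \<mu> x0 k s J" "s' = abra_state.truncate (trial_no k s J)"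
    using run_Suc[OF assms] by blast
  have "st_L s' = st_L (trial_no k s J)" by (simp add: J(2) abra_state.truncate_def)
  also have "\<dots> \<le> max (L_in k s J) (2 * L)"
    by (rule abra_step.Lnew_le[OF step_of_run[OF assms(1) J(1)]])
  also have "\<dots> \<le> max (L_in k s 0) (2 * L)"
    using L_in_bounds[OF assms(1) J(1)] by simp
  also have "\<dots> \<le> max (st_L s / 2) (2 * L)"
    using \<mu>_less \<mu>_nonneg by (auto simp: L_in_def)
  finally show ?thesis .
qed

lemma iteration_eta:
  assumes "run k = Some s" "run (Suc k) = Some s'" "0 < k"
  shows "0 < st_M s'" "0 < inverse (st_eta s)"
    "\<exists>t>0. inverse (st_eta s') = (1 - t) * inverse (st_eta s) \<and> st_M s' * t\<^sup>2 = inverse (st_eta s') + \<mu>"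
proof -
  obtain J where J: "executed d f \<mu> x0 k s J" "s' = abra_state.truncate (trial_no k s J)"
    using run_Suc[OF assms(1,2)] by blast
  let ?r = "trial_no k s J"
  interpret abra_step d f \<mu> L x0 k s "M_in k s J" "L_in k s J" "phibest_in k s J" "xbest_in k s J" ?r
    by (rule step_of_run[OF assms(1) J(1)])
  have eq: "st_M s' = st_M ?r" "st_eta s' = st_eta ?r" by (simp_all add: J(2) abra_state.truncate_def)
  show "0 < st_M s'" "0 < inverse (st_eta s)" using M_bounds e_pos assms(3) eq by simp_all
  show "\<exists>t>0. inverse (st_eta s') = (1 - t) * inverse (st_eta s) \<and> st_M s' * t\<^sup>2 = inverse (st_eta s') + \<mu>"
    unfolding eq using t_bounds(1) e'_step[OF assms(3)] trial_fields(3)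
    by (intro exI[of _ "st_t ?r"]) (simp only:, simp)
qed

text \<open>If the first trial is accepted, \<open>M\<close> has been divided by 4 and doubled once.
  Otherwise the accepted value is twice the last failed one, which is below
  \<open>\<rho>\<^sup>2 * (2 * L)\<close>.\<close>

lemma iteration_M_zero:
  assumes run: "run k = Some s" "run (Suc k) = Some s'" and dist: "local_dist_le k s \<rho>"
    and "\<mu> = 0" and L_le: "st_L s \<le> 2 * L"
  shows "st_M s' \<le> max (st_M s / 2) (4 * \<rho>\<^sup>2 * L)"
proof -
  obtain J where J: "executed d f \<mu> x0 k s J" "s' = abra_state.truncate (trial_no k s J)"
    using run_Suc[OF run] by blast
  have M': "st_M s' = 2 * M_in k s J"
    using st_M_trial[OF step_of_run[OF run(1) J(1)]] by (simp add: J(2) abra_state.truncate_def)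
  show ?thesis
  proof (cases J)
    case 0
    have "0 < st_M s" using run_valid[OF run(1)] by (simp add: valid_state_def)
    moreover have "2 * M_in k s 0 = max (st_M s / 2) (2 * \<mu>)" by (simp add: M_in_def)
    ultimately show ?thesis unfolding M' 0 using \<open>\<mu> = 0\<close> by simp
  next
    case (Suc j)
    then have exec: "executed d f \<mu> x0 k s j" and fail: "\<not> exits s (trial_no k s j)"
      using J(1) executed_Suc by blast+
    let ?r = "trial_no k s j"
    interpret abra_step d f \<mu> L x0 k s "M_in k s j" "L_in k s j" "phibest_in k s j" "xbest_in k s j" ?r
      by (rule step_of_run[OF run(1) exec])
    have "st_M ?r < \<rho>\<^sup>2 * st_L ?r"
      using exit_if_mu_zero[OF Omega_facts(1-7)[OF dist exec] \<open>\<mu> = 0\<close>] fail by force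
    also have "L_in k s 0 \<le> 2 * L"
      using L_le \<mu>_less \<mu>_nonneg by (simp add: L_in_def)
    then have "st_L ?r \<le> 2 * L"
      using Lnew_le L_in_bounds(2)[OF run(1) exec] by simp
    then have "\<rho>\<^sup>2 * st_L ?r \<le> \<rho>\<^sup>2 * (2 * L)" by (intro mult_left_mono) auto
    finally show ?thesis by (simp add: M' M_in_def Suc)
  qed
qed

text \<open>Provides the hypotheses \<open>ratio\<close> and \<open>step\<close> of
  \<open>eventually_bounded_by_ratio\<close> by following the ratio through the failed
  trials.\<close>

lemma iteration_M_pos:
  assumes run: "run k = Some s" "run (Suc k) = Some s'" and dist: "local_dist_le k s \<rho>"
    and "\<mu> > 0" and L_le: "st_L s \<le> 2 * L"
    and V: "2 * \<rho> ^ 4 \<le> V" "st_M s \<le> V * st_L s"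
  shows "st_M s' \<le> V * st_L s'"
    and "st_M s' \<le> max (st_M s / 2) (2 * \<rho> ^ 4 * (2 * L)) \<or> st_M s' \<le> max (V / 2) (2 * \<rho> ^ 4) * st_L s'"
proof -
  obtain J where J: "executed d f \<mu> x0 k s J" "s' = abra_state.truncate (trial_no k s J)"
    using run_Suc[OF run] by blast
  have \<rho>: "1 \<le> \<rho> ^ 4" using rho_ge_1[OF dist] by simp
  have L_in_le: "L_in k s j \<le> 2 * L" if "executed d f \<mu> x0 k s j" for j
    using L_in_bounds(2)[OF run(1) that] L_le \<mu>_less \<open>\<mu> > 0\<close> by (auto simp: L_in_def)
  have failed: "2 * st_M (trial_no k s j) \<le> V * st_L (trial_no k s j) \<and>
      (st_M (trial_no k s j) < 2 * \<rho> ^ 4 * L \<or> 2 * st_M (trial_no k s j) \<le> V / 2 * st_L (trial_no k s j))"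
    if "executed d f \<mu> x0 k s (Suc j)" "2 * M_in k s j \<le> V * L_in k s j" for j
  proof -
    have exec: "executed d f \<mu> x0 k s j" and fail: "\<not> exits s (trial_no k s j)"
      using that(1) executed_Suc by blast+
    note step = step_of_run[OF run(1) exec]
    have "st_M (trial_no k s j) \<le> V * L_in k s j" using that(2) st_M_trial[OF step] by simp
    from abra_step.failed_mu_pos[OF step Omega_facts(1-8)[OF dist exec] _ fail L_in_le[OF exec] V(1) this]
    show ?thesis using \<open>\<mu> > 0\<close> by blast
  qed
  have M_in_0: "2 * M_in k s 0 = max (st_M s / 2) (2 * \<mu>)" by (simp add: M_in_def)
  have ratio: "2 * M_in k s j \<le> V * L_in k s j" if "executed d f \<mu> x0 k s j" for j
    using that
  proof (induction j)
    case 0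
    \<comment> \<open>The first trial starts from halved \<open>M\<close> and halved
      \<open>L\<close> estimate, which keeps the ratio; where \<mu> cuts them off,
      \<open>V \<ge> 2\<close> suffices.\<close>
    have "2 * \<mu> \<le> V * \<mu>" using V(1) \<rho> \<open>\<mu> > 0\<close> by (intro mult_right_mono) auto
    moreover have "V * (st_L s / 2) \<le> V * L_in k s 0" "V * \<mu> \<le> V * L_in k s 0"
      using V(1) \<rho> by (auto simp: L_in_def intro!: mult_left_mono)
    ultimately show ?case unfolding M_in_0 using V(2) by auto
  next
    case (Suc j)
    then have "2 * M_in k s j \<le> V * L_in k s j" using executed_Suc by blast
    from failed[OF Suc.prems this] show ?case by (simp add: M_in_def L_in_def)
  qed
  note step = step_of_run[OF run(1) J(1)]
  have s': "st_M s' = 2 * M_in k s J" "st_L s' = st_L (trial_no k s J)"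
    using st_M_trial[OF step] by (simp_all add: J(2) abra_state.truncate_def)
  have L': "L_in k s J \<le> st_L s'" unfolding s' by (rule abra_step.Lnew_ge[OF step])
  have V_nonneg: "0 \<le> V" using V(1) \<rho> by simp
  show "st_M s' \<le> V * st_L s'"
    using ratio[OF J(1)] mult_left_mono[OF L' V_nonneg] unfolding s'(1) by linarith
  show "st_M s' \<le> max (st_M s / 2) (2 * \<rho> ^ 4 * (2 * L)) \<or> st_M s' \<le> max (V / 2) (2 * \<rho> ^ 4) * st_L s'"
  proof (cases J)
    case 0
    have "1 * \<mu> \<le> \<rho> ^ 4 * L" using \<rho> \<mu>_less \<open>\<mu> > 0\<close> by (intro mult_mono) auto
    then have "2 * \<mu> \<le> 2 * \<rho> ^ 4 * (2 * L)" using \<open>\<mu> > 0\<close> by linarith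
    then show ?thesis unfolding s'(1) 0 M_in_0 by (intro disjI1 max.mono) auto
  next
    case (Suc j)
    \<comment> \<open>The trial before the accepted one failed: either its \<open>M\<close> was
      below \<open>2 * \<rho> ^ 4 * L\<close>, or the bound \<open>V\<close> was halved.\<close>
    then have exec: "executed d f \<mu> x0 k s j" using J(1) executed_Suc by blast
    have M': "st_M s' = 2 * st_M (trial_no k s j)" and L_J: "L_in k s J = st_L (trial_no k s j)"
      by (simp_all add: s'(1) M_in_def L_in_def Suc)
    have "V / 2 * L_in k s J \<le> max (V / 2) (2 * \<rho> ^ 4) * st_L s'"
      using L' V_nonneg abra_step.Lo(2)[OF step] by (intro mult_mono) auto
    then show ?thesis
      using failed[OF J(1)[unfolded Suc] ratio[OF exec]] unfolding M' L_J by auto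
  qed
qed

text \<open>By optimality of \<open>st_z s\<close>, the regularized minorant at \<open>x\<close>
  exceeds its value at \<open>st_z s\<close> by a nonnegative multiple of
  \<open>D x (st_z s)\<close>.\<close>

lemma phi_best_bound:
  assumes run: "run k = Some s" and "0 < k" and x: "x \<in> U"
  shows "st_phibest s \<le> \<phi> x + inverse (st_eta s) * D x x0"
proof -
  let ?e = "inverse (st_eta s)" and ?z = "st_z s"
  have s: "?z \<in> U" "0 < ?e" "estimate s" and opt: "st_lambda s + (\<mu> + ?e) *\<^sub>R (G ?z - G x0) = 0"
    using run_valid[OF run] \<open>0 < k\<close> by (simp_all add: valid_state_def)
  obtain A where A: "st_phibest s \<le> A + st_lambda s \<bullet> ?z + (\<mu> + ?e) * D ?z x0"
      "A + st_lambda s \<bullet> x \<le> f x"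
    using s(3) x unfolding estimate_def by blast
  have "(\<mu> + ?e) * D x x0 = (\<mu> + ?e) * D x ?z + (\<mu> + ?e) * D ?z x0 + ((\<mu> + ?e) *\<^sub>R (G ?z - G x0)) \<bullet> (x - ?z)"
    unfolding three_point[OF x s(1) x0] by (simp add: algebra_simps)
  also have "(\<mu> + ?e) *\<^sub>R (G ?z - G x0) = - st_lambda s"
    using opt by (simp add: add_eq_0_iff2)
  finally have eq: "(\<mu> + ?e) * D x x0
      = (\<mu> + ?e) * D x ?z + (\<mu> + ?e) * D ?z x0 - st_lambda s \<bullet> x + st_lambda s \<bullet> ?z"
    by (simp add: inner_diff_right)
  have "0 \<le> (\<mu> + ?e) * D x ?z"
    using \<mu>_nonneg s(2) D_nonneg[OF U_edom[OF x] s(1)] by simp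
  then have "st_phibest s \<le> f x + (\<mu> + ?e) * D x x0" using A eq by linarith
  also have "\<dots> = \<phi> x + ?e * D x x0" unfolding phi_eq[OF x] by (simp add: distrib_right)
  finally show ?thesis .
qed

end

section \<open>Exit of all iterations and eventual bound on \<open>M\<close>\<close>

context abra_gd
begin

abbreviation "state k \<equiv> the (run k)"

text \<open>The distortion hypothesis speaks only of iterations that are reached, so exit and
  reachability are proved together.\<close>

lemma all_iterations_exit:
  assumes before: "\<And>k. k < K \<Longrightarrow> inner_loop_exits d f \<mu> x0 L0 Minit k"
    and dist: "\<And>k s. K \<le> k \<Longrightarrow> run k = Some s \<Longrightarrow> local_dist_le k s \<rho>"
  shows "inner_loop_exits d f \<mu> x0 L0 Minit k" and "run k = Some (state k)"
proof -
  have "inner_loop_exits d f \<mu> x0 L0 Minit k \<and> run k \<noteq> None" for k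
  proof (induction k)
    case 0
    have "\<exists>j. exits (initial_state d f \<mu> x0 L0 Minit) (trial_no 0 (initial_state d f \<mu> x0 L0 Minit) j)"
      if "K = 0" using that dist by (intro inner_loop_terminates[where \<rho> = \<rho>]) auto
    then show ?case using before[of 0] by (cases "K = 0") (auto simp: inner_loop_exits_def)
  next
    case (Suc k)
    then obtain s0 where "run k = Some s0" "\<exists>j. exits s0 (trial_no k s0 j)"
      by (auto simp: inner_loop_exits_def)
    then have "run (Suc k) \<noteq> None" by simp
    then obtain s where s: "run (Suc k) = Some s" by blast
    have "\<exists>j. exits s (trial_no (Suc k) s j)" if "K \<le> Suc k"
      using that dist s by (intro inner_loop_terminates[where \<rho> = \<rho>])
    then show ?case
      using before[of "Suc k"] s by (cases "K \<le> Suc k") (auto simp: inner_loop_exits_def simp del: abra_run.simps(2))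
  qed
  then show "inner_loop_exits d f \<mu> x0 L0 Minit k" "run k = Some (state k)" by auto
qed

text \<open>The \<open>L\<close> estimates settle at or below \<open>2 * L\<close> first, as both
  recursions for \<open>M\<close> presuppose this.\<close>

lemma M_eventually_bounded:
  assumes run: "\<And>k. run k = Some (state k)" and dist: "\<And>k. K \<le> k \<Longrightarrow> local_dist_le k (state k) \<rho>"
  shows "\<exists>N\<ge>K. \<forall>k\<ge>N. st_M (state k) \<le> (if \<mu> = 0 then 4 * \<rho>\<^sup>2 * L else 4 * \<rho> ^ 4 * L)"
proof -
  have L_pos: "0 < L" using \<mu>_nonneg \<mu>_less by simp
  have \<rho>: "1 \<le> \<rho>" using rho_ge_1 dist by blast
  obtain N0 where "N0 \<ge> 0" and N0: "\<forall>k\<ge>N0. st_L (state k) \<le> 2 * L"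
    using eventually_halved[of "2 * L" 0 "\<lambda>k. st_L (state k)"] iteration_L[OF run run] L_pos by auto
  define N where "N = max N0 K"
  have L_le: "st_L (state k) \<le> 2 * L" if "N \<le> k" for k
    using that N0 by (simp add: N_def)
  have dist': "local_dist_le k (state k) \<rho>" if "N \<le> k" for k
    using that dist by (simp add: N_def)
  show ?thesis
  proof (cases "\<mu> = 0")
    case True
    have "0 < 4 * \<rho>\<^sup>2 * L" using \<rho> L_pos by simp
    moreover have "st_M (state (Suc k)) \<le> max (st_M (state k) / 2) (4 * \<rho>\<^sup>2 * L)" if "N \<le> k" for k
      using iteration_M_zero[OF run run dist'[OF that] True L_le[OF that]] .
    ultimately obtain N' where "N' \<ge> N" "\<forall>k\<ge>N'. st_M (state k) \<le> 4 * \<rho>\<^sup>2 * L"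
      using eventually_halved[of "4 * \<rho>\<^sup>2 * L" N "\<lambda>k. st_M (state k)"] by blast
    then show ?thesis using True by (intro exI[of _ N']) (auto simp: N_def)
  next
    case False
    then have \<mu>: "\<mu> > 0" using \<mu>_nonneg by simp
    have "\<exists>N'\<ge>N. \<forall>k\<ge>N'. st_M (state k) \<le> 2 * \<rho> ^ 4 * (2 * L)"
    proof (rule eventually_bounded_by_ratio)
      show "0 < 2 * \<rho> ^ 4" "0 < 2 * L" using \<rho> L_pos by auto
      show "0 < st_L (state k) \<and> st_L (state k) \<le> 2 * L" if "N \<le> k" for k
        using run_valid[OF run[of k]] L_le[OF that] by (simp add: valid_state_def)
      fix k V
      assume "N \<le> k" and V: "2 * \<rho> ^ 4 \<le> V" "st_M (state k) \<le> V * st_L (state k)"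
      then show "st_M (state (Suc k)) \<le> V * st_L (state (Suc k))"
        "st_M (state (Suc k)) \<le> max (st_M (state k) / 2) (2 * \<rho> ^ 4 * (2 * L)) \<or>
          st_M (state (Suc k)) \<le> max (V / 2) (2 * \<rho> ^ 4) * st_L (state (Suc k))"
        using iteration_M_pos[OF run run dist' \<mu> L_le V] by blast+
    qed
    moreover have "2 * \<rho> ^ 4 * (2 * L) = 4 * \<rho> ^ 4 * L" by simp
    ultimately obtain N' where "N' \<ge> N" "\<forall>k\<ge>N'. st_M (state k) \<le> 4 * \<rho> ^ 4 * L" by metis
    then show ?thesis using False by (intro exI[of _ N']) (auto simp: N_def)
  qed
qed

end

theorem theorem3:
  fixes d :: "real^'n \<Rightarrow> ereal" and f :: "real^'n \<Rightarrow> real"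
    and \<mu> L L0 Minit \<rho> :: real and x0 :: "real^'n" and K :: nat
  assumes "legendre d"
    and "bij_betw (egradient d) (interior (edom d)) (interior (edom (conjugate d)))"
    and "\<forall>x\<in>interior (edom d). egradient (conjugate d) (egradient d x) = x"
    and "x0 \<in> interior (edom d)"
    and "convex_on (closure (edom d)) f"
    and "\<forall>x\<in>interior (closure (edom d)). \<exists>v. GDERIV f x :> v"
    and "relatively_smooth (L - \<mu>) d (interior (closure (edom d))) f"
    and "0 \<le> \<mu>" and "\<mu> < L"
    and "L0 > 0" and "Minit > 0"
    and "minimizers_interior d (closure (edom d)) (objective d f \<mu> x0)"
    and "subproblems_solvable d f \<mu> x0 L0 Minit"
    and "\<forall>w\<in>interior (edom (conjugate d)). twice_differentiable_at (conjugate d) w"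
    and "\<forall>k<K. inner_loop_exits d f \<mu> x0 L0 Minit k"
    and "\<forall>k\<ge>K. \<forall>s. abra_run d f \<mu> x0 L0 Minit k = Some s \<longrightarrow>
           local_distortion_le d f \<mu> x0 k s \<rho>"
  shows "(\<forall>k. inner_loop_exits d f \<mu> x0 L0 Minit k) \<and>
    (\<exists>Kbar\<ge>K. Kbar \<ge> 1 \<and>
      (\<forall>k\<ge>Kbar.
         (\<mu> = 0 \<longrightarrow> accepted_M d f \<mu> x0 L0 Minit k \<le> 4 * \<rho>^2 * L) \<and>
         (\<mu> > 0 \<longrightarrow> accepted_M d f \<mu> x0 L0 Minit k \<le> 4 * \<rho>^4 * L)) \<and>
      (\<forall>xstar k. is_arg_min (objective d f \<mu> x0) (\<lambda>x. x \<in> closure (edom d)) xstar \<longrightarrow> k \<ge> Kbar \<longrightarrow>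
         ereal (phi_best d f \<mu> x0 L0 Minit k) - (INF x\<in>closure (edom d). objective d f \<mu> x0 x)
           \<le> ereal (inverse (eta d f \<mu> x0 L0 Minit k)) * bregman d xstar x0) \<and>
      (\<forall>k\<ge>Kbar.
         (\<mu> = 0 \<longrightarrow>
            inverse (eta d f \<mu> x0 L0 Minit k)
              \<le> inverse (eta d f \<mu> x0 L0 Minit Kbar) /
                  (1 + (real k - real Kbar) / (4 * \<rho> * sqrt (L * eta d f \<mu> x0 L0 Minit Kbar)))^2) \<and>
         (\<mu> > 0 \<longrightarrow>
            inverse (eta d f \<mu> x0 L0 Minit k)
              \<le> inverse (eta d f \<mu> x0 L0 Minit Kbar) *
                  (1 - sqrt (\<mu> / (4 * \<rho>^4 * L))) ^ (k - Kbar))))"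
proof -
  interpret abra_gd d f \<mu> L x0 L0 Minit
    using assms(1-11,13,14) by unfold_locales auto
  have run: "run k = Some (state k)" and exits_all: "inner_loop_exits d f \<mu> x0 L0 Minit k" for k
    using all_iterations_exit[of K \<rho> k] assms(15,16) by blast+
  have dist: "local_dist_le k (state k) \<rho>" if "K \<le> k" for k
    using assms(16) run that by blast
  have L_pos: "0 < L" using \<mu>_nonneg \<mu>_less by simp
  have \<rho>: "1 \<le> \<rho>" using rho_ge_1 dist by blast
  obtain N where "N \<ge> K" and N: "\<forall>k\<ge>N. st_M (state k) \<le> (if \<mu> = 0 then 4 * \<rho>\<^sup>2 * L else 4 * \<rho> ^ 4 * L)"
    using M_eventually_bounded[OF run dist] by blast
  \<comment> \<open>Index 0 is excluded: there \<open>st_eta\<close> is 0 in place of an infinite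
    inverse.\<close>
  define Kbar where "Kbar = max N 1"
  \<comment> \<open>The \<open>M\<close> accepted in iteration \<open>k\<close> is stored in the
    state entering iteration \<open>k + 1\<close>, hence the shift in \<open>m\<close>.\<close>
  define e m where "e k = inverse (st_eta (state k))" and "m k = st_M (state (Suc k))" for k
  have eta_e: "inverse (eta d f \<mu> x0 L0 Minit k) = e k" for k
    by (simp add: eta_def e_def)
  have acc_m: "accepted_M d f \<mu> x0 L0 Minit k = m k" for k
    by (simp only: accepted_M_def m_def)
  have m_le: "m k \<le> (if \<mu> = 0 then 4 * \<rho>\<^sup>2 * L else 4 * \<rho> ^ 4 * L)" if "Kbar \<le> k" for k
    using N that unfolding m_def by (simp add: Kbar_def del: abra_run.simps)
  have e_pos: "0 < e k" and m_pos: "0 < m k"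
    and e_step: "\<exists>t>0. e (Suc k) = (1 - t) * e k \<and> m k * t\<^sup>2 = e (Suc k) + \<mu>" if "Kbar \<le> k" for k
  proof -
    have "0 < k" using that by (simp add: Kbar_def)
    from iteration_eta[OF run run this] show "0 < e k" "0 < m k"
      "\<exists>t>0. e (Suc k) = (1 - t) * e k \<and> m k * t\<^sup>2 = e (Suc k) + \<mu>"
      unfolding e_def m_def by blast+
  qed
  have best: "ereal (phi_best d f \<mu> x0 L0 Minit k) - (INF x\<in>closure (edom d). objective d f \<mu> x0 x)
      \<le> ereal (inverse (eta d f \<mu> x0 L0 Minit k)) * bregman d xstar x0"
    if xstar: "is_arg_min (objective d f \<mu> x0) (\<lambda>x. x \<in> closure (edom d)) xstar" and "Kbar \<le> k" for xstar k
  proof -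
    have U: "xstar \<in> U" using assms(12) xstar by (simp add: minimizers_interior_def)
    have "(INF x\<in>closure (edom d). objective d f \<mu> x0 x) = objective d f \<mu> x0 xstar"
      using xstar by (intro antisym INF_lower INF_greatest) (auto simp: is_arg_min_def not_less)
    also have "\<dots> = ereal (\<phi> xstar)"
      using objective_real[OF U] by simp
    finally have inf: "(INF x\<in>closure (edom d). objective d f \<mu> x0 x) = ereal (\<phi> xstar)" .
    define b where "b = D xstar x0"
    have breg: "bregman d xstar x0 = ereal b"
      using bregman_real[OF U_edom[OF U] x0] by (simp add: b_def)
    have "0 < k" using \<open>Kbar \<le> k\<close> by (simp add: Kbar_def)
    from phi_best_bound[OF run this U]
    have "phi_best d f \<mu> x0 L0 Minit k - \<phi> xstar \<le> e k * b"
      by (simp add: phi_best_def e_def b_def)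
    then show ?thesis unfolding inf breg eta_e by simp
  qed
  have rate_zero: "e k \<le> e Kbar / (1 + (real k - real Kbar) / (4 * \<rho> * sqrt (L * eta d f \<mu> x0 L0 Minit Kbar)))\<^sup>2"
    if "\<mu> = 0" "Kbar \<le> k" for k
  proof -
    have "e k \<le> e Kbar / (1 + (real k - real Kbar) * sqrt (e Kbar) / (2 * sqrt (4 * \<rho>\<^sup>2 * L)))\<^sup>2"
    proof (rule quadratic_rate[where m = m])
      show "0 < 4 * \<rho>\<^sup>2 * L" using \<rho> L_pos by simp
      show "\<exists>t>0. e (Suc k) = (1 - t) * e k \<and> m k * t\<^sup>2 = e (Suc k)" if "Kbar \<le> k" for k
        using e_step[OF that] \<open>\<mu> = 0\<close> by simp
      show "0 < m k \<and> m k \<le> 4 * \<rho>\<^sup>2 * L" if "Kbar \<le> k" for k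
        using m_pos[OF that] m_le[OF that] \<open>\<mu> = 0\<close> by simp
    qed (use that e_pos in auto)
    \<comment> \<open>With the factor 2 of the quadratic rate this produces the constant
      \<open>4 * \<rho>\<close>.\<close>
    also have "sqrt (4 * \<rho>\<^sup>2 * L) = 2 * \<rho> * sqrt L"
      using \<rho> by (simp add: real_sqrt_mult)
    also have "sqrt (e Kbar) = 1 / sqrt (eta d f \<mu> x0 L0 Minit Kbar)"
      by (simp add: eta_e[symmetric] inverse_eq_divide real_sqrt_divide)
    finally show ?thesis by (simp add: real_sqrt_mult mult_ac)
  qed
  have rate_pos: "e k \<le> e Kbar * (1 - sqrt (\<mu> / (4 * \<rho> ^ 4 * L))) ^ (k - Kbar)"
    if "\<mu> > 0" "Kbar \<le> k" for k
  proof (rule linear_rate[where m = m])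
    have "1 \<le> 4 * \<rho> ^ 4" using one_le_power[OF \<rho>, of 4] by linarith
    then have "1 * \<mu> \<le> (4 * \<rho> ^ 4) * L"
      using \<mu>_less \<open>\<mu> > 0\<close> by (intro mult_mono) auto
    then show "\<mu> \<le> 4 * \<rho> ^ 4 * L" by simp
    show "0 < m k \<and> m k \<le> 4 * \<rho> ^ 4 * L" if "Kbar \<le> k" for k
      using m_pos[OF that] m_le[OF that] \<open>\<mu> > 0\<close> by simp
  qed (use that e_pos e_step in auto)
  show ?thesis
    unfolding acc_m
  proof (intro conjI allI exI[of _ Kbar] impI)
    show "Kbar \<ge> K" "Kbar \<ge> 1" using \<open>N \<ge> K\<close> by (auto simp: Kbar_def)
    show "m k \<le> 4 * \<rho>\<^sup>2 * L" if "Kbar \<le> k" "\<mu> = 0" for k using m_le that by simp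
    show "m k \<le> 4 * \<rho> ^ 4 * L" if "Kbar \<le> k" "\<mu> > 0" for k using m_le[of k] that by simp
  qed (use exits_all best rate_zero[folded eta_e] rate_pos[folded eta_e] in blast)+
qed

end
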